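(* Let $(\phi_t)_{t\ge 0}$ be a non-elliptic semigroup of holomorphic functions in the unit disk $\mathbb{D}$. Suppose that $\gamma:[0,+\infty)\to\mathbb{D}$ is a regular backward orbit for $(\phi_t)$ that converges non-tangentially to a point of the unit circle $\partial\mathbb{D}$ as $t\to+\infty$. Then $\gamma$ is a quasi-geodesic for the hyperbolic distance $k_{\mathbb{D}}$ of the unit disk.
   Context: A semigroup in $\mathbb{D}=\{z\in\mathbb{C}:|z|<1\}$ is a family $(\phi_t)_{t\ge0}$ of holomorphic self-maps of $\mathbb{D}$ such that (i) $\phi_0$ is the identity of $\mathbb{D}$; (ii) $\phi_{t+s}(z)=\phi_t(\phi_s(z))$ for all $z\in\mathbb{D}$ and $t,s\ge0$; (iii) $\lim_{t\to s}\phi_t(z)=\phi_s(z)$ for all $z\in\mathbb{D}$ and $s\ge0$. It is called non-elliptic if, for some (equivalently, every) $t>0$, $\phi_t$ has no fixed point in $\mathbb{D}$. The hyperbolic density of $\mathbb{D}$ is $\lambda_{\mathbb{D}}(z)=\frac{1}{1-|z|^2}$, and the hyperbolic distance is $k_{\mathbb{D}}(z,w)=\inf_\eta\int_\eta\lambda_{\mathbb{D}}(\zeta)|d\zeta|$, the infimum being over all smooth curves $\eta$ in $\mathbb{D}$ joining $z$ and $w$. The hyperbolic length of a curve $\gamma$ in $\mathbb{D}$ between $\gamma(t_1)$ and $\gamma(t_2)$, $t_1\le t_2$, is $l_{\mathbb{D}}(\gamma;[t_1,t_2])=\int_{t_1}^{t_2}\lambda_{\mathbb{D}}(\gamma(t))|\gamma'(t)|\,dt$.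 A backward orbit for $(\phi_t)$ is a continuous curve $\gamma:[0,+\infty)\to\mathbb{D}$ such that $\phi_s(\gamma(t))=\gamma(t-s)$ for every $t\in(0,+\infty)$ and every $s\in[0,t]$. It is called regular if $\limsup_{t\to+\infty}k_{\mathbb{D}}(\gamma(t),\gamma(t+1))<+\infty$. The curve $\gamma$ converges non-tangentially to $\sigma\in\partial\mathbb{D}$ if $\gamma(t)\to\sigma$ as $t\to+\infty$ and $\gamma(t)$ lies, for all large $t$, in a Stolz angle $\{z\in\mathbb{D}:|\sigma-z|<M(1-|z|)\}$ for some $M>1$. A quasi-geodesic for $k_{\mathbb{D}}$ is a curve $\gamma:[0,+\infty)\to\mathbb{D}$ that is Lipschitz (with respect to the Euclidean distance), satisfies $\lim_{t\to+\infty}k_{\mathbb{D}}(\gamma(0),\gamma(t))=+\infty$, and for which there exist constants $A\ge1$ and $B\ge0$ such that $$l_{\mathbb{D}}(\gamma;[t_1,t_2])\le A\cdot k_{\mathbb{D}}(\gamma(t_1),\gamma(t_2))+B\quad\text{for all } t_2\ge t_1\ge0.$$ *)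

theory Defs
  imports "HOL-Analysis.Analysis"
begin

abbreviation unit_disk :: "complex set" where
  "unit_disk \<equiv> ball 0 1"

definition disk_semigroup :: "(real \<Rightarrow> complex \<Rightarrow> complex) \<Rightarrow> bool" where
  "disk_semigroup \<phi> \<longleftrightarrow>
     (\<forall>t\<ge>0. \<phi> t holomorphic_on unit_disk \<and> \<phi> t \<in> unit_disk \<rightarrow> unit_disk) \<and>
     (\<forall>z\<in>unit_disk. \<phi> 0 z = z) \<and>
     (\<forall>t\<ge>0. \<forall>s\<ge>0. \<forall>z\<in>unit_disk. \<phi> (t + s) z = \<phi> t (\<phi> s z)) \<and>
     (\<forall>s\<ge>0. \<forall>z\<in>unit_disk. ((\<lambda>t. \<phi> t z) \<longlongrightarrow> \<phi> s z) (at s within {0..}))"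

definition non_elliptic :: "(real \<Rightarrow> complex \<Rightarrow> complex) \<Rightarrow> bool" where
  "non_elliptic \<phi> \<longleftrightarrow> (\<exists>t>0. \<forall>z\<in>unit_disk. \<phi> t z \<noteq> z)"

definition hyp_density :: "complex \<Rightarrow> real" where
  "hyp_density z = 1 / (1 - (norm z)\<^sup>2)"

text \<open>For a curve that is Lipschitz on the interval and stays in the disk, the derivative exists
  almost everywhere and the integrand is bounded and measurable, so the integral below exists
  (the value of \<open>vector_derivative\<close> on the exceptional null set is irrelevant). The length is used
  only for such curves.\<close>
definition hyp_length :: "(real \<Rightarrow> complex) \<Rightarrow> real \<Rightarrow> real \<Rightarrow> real" where
  "hyp_length \<gamma> t1 t2 =
     integral {t1..t2}
       (\<lambda>t. hyp_density (\<gamma> t) * norm (vector_derivative \<gamma> (at t within {t1..t2})))"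

text \<open>Smooth means continuously differentiable. Curves are parametrized by the unit interval, which
  is no restriction since the length does not depend on the parametrization.\<close>
definition smooth_curves_joining :: "complex \<Rightarrow> complex \<Rightarrow> (real \<Rightarrow> complex) set" where
  "smooth_curves_joining z w =
     {\<eta>. \<eta> C1_differentiable_on {0..1} \<and> \<eta> \<in> {0..1} \<rightarrow> unit_disk \<and> \<eta> 0 = z \<and> \<eta> 1 = w}"

definition hyp_dist :: "complex \<Rightarrow> complex \<Rightarrow> real" where
  "hyp_dist z w = (INF \<eta>\<in>smooth_curves_joining z w. hyp_length \<eta> 0 1)"

definition backward_orbit :: "(real \<Rightarrow> complex \<Rightarrow> complex) \<Rightarrow> (real \<Rightarrow> complex) \<Rightarrow> bool" where
  "backward_orbit \<phi> \<gamma> \<longleftrightarrow>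
     continuous_on {0..} \<gamma> \<and> \<gamma> \<in> {0..} \<rightarrow> unit_disk \<and>
     (\<forall>t>0. \<forall>s\<in>{0..t}. \<phi> s (\<gamma> t) = \<gamma> (t - s))"

definition regular_backward_orbit ::
    "(real \<Rightarrow> complex \<Rightarrow> complex) \<Rightarrow> (real \<Rightarrow> complex) \<Rightarrow> bool" where
  "regular_backward_orbit \<phi> \<gamma> \<longleftrightarrow>
     backward_orbit \<phi> \<gamma> \<and> Limsup at_top (\<lambda>t. ereal (hyp_dist (\<gamma> t) (\<gamma> (t + 1)))) < \<infinity>"

definition stolz_angle :: "complex \<Rightarrow> real \<Rightarrow> complex set" where
  "stolz_angle \<sigma> M = {z \<in> unit_disk. norm (\<sigma> - z) < M * (1 - norm z)}"

definition converges_non_tangentially :: "(real \<Rightarrow> complex) \<Rightarrow> complex \<Rightarrow> bool" where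
  "converges_non_tangentially \<gamma> \<sigma> \<longleftrightarrow>
     (\<gamma> \<longlongrightarrow> \<sigma>) at_top \<and> (\<exists>M>1. \<forall>\<^sub>F t in at_top. \<gamma> t \<in> stolz_angle \<sigma> M)"

definition quasi_geodesic :: "(real \<Rightarrow> complex) \<Rightarrow> bool" where
  "quasi_geodesic \<gamma> \<longleftrightarrow>
     \<gamma> \<in> {0..} \<rightarrow> unit_disk \<and>
     (\<exists>L. L-lipschitz_on {0..} \<gamma>) \<and>
     filterlim (\<lambda>t. hyp_dist (\<gamma> 0) (\<gamma> t)) at_top at_top \<and>
     (\<exists>A B. A \<ge> 1 \<and> B \<ge> 0 \<and>
        (\<forall>t1 t2. 0 \<le> t1 \<and> t1 \<le> t2 \<longrightarrow>
           hyp_length \<gamma> t1 t2 \<le> A * hyp_dist (\<gamma> t1) (\<gamma> t2) + B))"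

end

theory Submission
  imports Defs "HOL-Complex_Analysis.Riemann_Mapping"
begin

text \<open>Let \<open>\<tau>\<close> be the Denjoy-Wolff point, \<open>horo \<tau>\<close> the Poisson kernel at \<open>\<tau>\<close> and \<open>C\<close> the Cayley transform
  with \<open>Re C = horo \<tau>\<close>. By Julia's inequality the functions \<open>C (\<phi> h z) - C z\<close> have nonnegative real part,
  so Harnack's inequality applies to them. Monotonicity of \<open>horo \<tau>\<close> along \<open>\<gamma>\<close> and nontangential
  convergence force \<open>\<sigma> \<noteq> \<tau>\<close>; then Harnack for \<open>h = 1\<close> gives geometric decay of \<open>horo \<tau> (\<gamma> t)\<close>, hence
  \<open>1 - \<bar>\<gamma> t\<bar> \<le> K exp (- c t)\<close> and a linear lower bound for the hyperbolic distance along \<open>\<gamma>\<close>.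
  Conversely, regularity and nontangential convergence keep \<open>\<gamma> (t + s)\<close>, \<open>0 \<le> s \<le> 1\<close>, at bounded hyperbolic
  distance from \<open>\<gamma> t\<close>, so by Harnack for \<open>h = 1/n\<close> the \<open>n\<close> increments of \<open>C \<circ> \<gamma>\<close> over \<open>[t, t + 1]\<close> are
  comparable to their mean. This bounds the hyperbolic speed of \<open>\<gamma>\<close>. No infinitesimal generator is
  needed: differentiability of \<open>\<gamma>\<close> follows from Harnack bounds on second differences.\<close>

section \<open>Pseudo-hyperbolic distance and Harnack inequalities\<close>

definition pdist :: "complex \<Rightarrow> complex \<Rightarrow> real" where
  "pdist z w = norm (z - w) / norm (1 - cnj w * z)"

lemma pdist_eq_Moebius: "pdist z w = norm (Moebius_function 0 w z)"
  by (simp add: pdist_def Moebius_function_simple norm_divide)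

lemma pdist_nonneg [simp]: "0 \<le> pdist z w"
  by (simp add: pdist_def)

lemma pdist_self [simp]: "pdist z z = 0"
  by (simp add: pdist_def)

lemma pdist_0_right [simp]: "pdist z 0 = norm z"
  by (simp add: pdist_def)

lemma norm_one_minus_cnj_commute: "norm (1 - cnj w * z) = norm (1 - cnj z * w)"
  by (metis complex_cnj_cnj complex_cnj_diff complex_cnj_mult complex_cnj_one complex_mod_cnj mult.commute)

lemma pdist_commute: "pdist z w = pdist w z"
  unfolding pdist_def by (metis norm_minus_commute norm_one_minus_cnj_commute)

lemma one_minus_cnj_ge:
  assumes "norm w < 1" shows "norm (1 - cnj w * z) \<ge> 1 - norm z"
proof -
  have "norm (cnj w * z) \<le> norm z"
    using assms by (simp add: norm_mult mult_left_le_one_le)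
  then show ?thesis
    using norm_triangle_ineq2[of 1 "cnj w * z"] by simp
qed

lemma one_minus_cnj_pos:
  assumes "norm w < 1" "norm z < 1" shows "norm (1 - cnj w * z) > 0"
  using one_minus_cnj_ge[OF assms(1), of z] assms(2) by linarith

lemma pdist_lt_1: "norm z < 1 \<Longrightarrow> norm w < 1 \<Longrightarrow> pdist z w < 1"
  by (simp add: pdist_eq_Moebius Moebius_function_norm_lt_1)

lemma norm_one_minus_cnj_sq:
  "(norm (1 - cnj w * z))\<^sup>2 - (norm (z - w))\<^sup>2 = (1 - (norm z)\<^sup>2) * (1 - (norm w)\<^sup>2)"
  unfolding cmod_power2 by (simp add: power2_eq_square algebra_simps)

text \<open>This identity translates between pseudo-hyperbolic distance and distance to the unit
  circle; the Julia inequality and both comparison lemmas for boundary distances start from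
  it.\<close>

lemma one_minus_pdist_sq:
  assumes "norm z < 1" "norm w < 1"
  shows "1 - (pdist z w)\<^sup>2 = (1 - (norm z)\<^sup>2) * (1 - (norm w)\<^sup>2) / (norm (1 - cnj w * z))\<^sup>2"
  using one_minus_cnj_pos[OF assms(2,1)] norm_one_minus_cnj_sq[of w z]
  by (simp add: pdist_def field_simps)

lemma pdist_le_divide:
  assumes "norm z < 1" "norm w < 1"
  shows "pdist z w \<le> norm (z - w) / (1 - norm z)"
  unfolding pdist_def using one_minus_cnj_ge[OF assms(2), of z] assms
  by (intro divide_left_mono) (auto intro: mult_pos_pos one_minus_cnj_pos)

lemma norm_diff_le_pdist:
  assumes "norm z < 1" "norm w < 1"
  shows "norm (z - w) \<le> 2 * pdist z w"
proof -
  have "norm (1 - cnj w * z) \<le> 1 + norm (cnj w * z)"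
    using norm_triangle_ineq4[of 1 "cnj w * z"] by simp
  also have "norm (cnj w * z) \<le> 1"
    using assms by (simp add: norm_mult mult_le_one)
  finally have "pdist z w * norm (1 - cnj w * z) \<le> pdist z w * 2"
    by (intro mult_left_mono) auto
  then show ?thesis
    using one_minus_cnj_pos[OF assms(2,1)] by (simp add: pdist_def mult.commute)
qed

text \<open>Moebius transformations move \<open>w\<close> and \<open>f w\<close> to
  \<open>0\<close>, where the Schwarz lemma applies.\<close>

lemma Schwarz_Pick:
  assumes f: "f holomorphic_on unit_disk" and im: "f \<in> unit_disk \<rightarrow> unit_disk"
    and z: "norm z < 1" and w: "norm w < 1"
  shows "pdist (f z) (f w) \<le> pdist z w"
proof -
  define h where "h = Moebius_function 0 (f w) \<circ> f \<circ> Moebius_function 0 (- w)"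
  have fw: "norm (f w) < 1" using im w by (auto simp: Pi_iff)
  have M: "Moebius_function 0 (- w) ` unit_disk \<subseteq> unit_disk"
    using w Moebius_function_norm_lt_1[of "-w" _ 0] by auto
  have "h holomorphic_on unit_disk"
    unfolding h_def
    by (intro holomorphic_on_compose_gen[where t = unit_disk] f Moebius_function_holomorphic)
       (use M im w fw in auto)
  moreover have "h 0 = 0"
    by (simp add: h_def Moebius_function_of_zero Moebius_function_eq_zero)
  moreover have "norm (h u) < 1" if "norm u < 1" for u
    using that fw M im by (auto simp: h_def Pi_iff image_subset_iff intro!: Moebius_function_norm_lt_1)
  ultimately have "norm (h u) \<le> norm u" if "norm u < 1" for u
    using Schwarz_Lemma(1) that by blast
  from this[of "Moebius_function 0 w z"] show ?thesis
    using w z by (simp add: h_def Moebius_function_norm_lt_1 Moebius_function_compose pdist_eq_Moebius)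
qed

text \<open>The map \<open>f\<close> is \<open>G\<close> followed by the transformation of the right
  half-plane onto the disk that sends \<open>G w\<close> to \<open>0\<close>. Schwarz-Pick bounds
  \<open>norm (f z)\<close> by \<open>pdist z w\<close>, and solving for \<open>G z - G w\<close>
  gives the estimate.\<close>

lemma Harnack_aux:
  assumes G: "G holomorphic_on unit_disk" and pos: "\<And>z. norm z < 1 \<Longrightarrow> Re (G z) > 0"
    and z: "norm z < 1" and w: "norm w < 1"
  shows "(1 - pdist z w) * norm (G z - G w) \<le> 2 * pdist z w * Re (G w)"
proof -
  define f where "f = (\<lambda>z. (G z - G w) / (G z + cnj (G w)))"
  have nz: "G u + cnj (G w) \<noteq> 0" if "norm u < 1" for u
    using pos[OF that] pos[OF w] by (auto simp: complex_eq_iff)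
  have "f holomorphic_on unit_disk"
    unfolding f_def by (intro holomorphic_intros G) (use nz in auto)
  moreover have "f \<in> unit_disk \<rightarrow> unit_disk"
  proof
    fix u :: complex assume "u \<in> unit_disk"
    then have u: "norm u < 1" by simp
    have "(norm (G u + cnj (G w)))\<^sup>2 - (norm (G u - G w))\<^sup>2 = 4 * Re (G u) * Re (G w)"
      unfolding cmod_power2 by (simp add: power2_eq_square algebra_simps)
    moreover have "4 * Re (G u) * Re (G w) > 0"
      using pos[OF u] pos[OF w] by simp
    ultimately have "(norm (G u - G w))\<^sup>2 < (norm (G u + cnj (G w)))\<^sup>2"
      by linarith
    then have "norm (G u - G w) < norm (G u + cnj (G w))"
      by (rule power2_less_imp_less) simp
    then show "f u \<in> unit_disk"
      using nz[OF u] by (simp add: f_def norm_divide)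
  qed
  ultimately have "norm (f z) \<le> pdist z w"
    using Schwarz_Pick[OF _ _ z w, of f] by (simp add: f_def)
  then have "norm (G z - G w) \<le> pdist z w * norm (G z + cnj (G w))"
    using nz[OF z] by (simp add: f_def norm_divide divide_le_eq)
  also have "G z + cnj (G w) = (G z - G w) + of_real (2 * Re (G w))"
    by (simp add: complex_eq_iff)
  also have "pdist z w * norm \<dots> \<le> pdist z w * (norm (G z - G w) + 2 * Re (G w))"
    using norm_triangle_ineq[of "G z - G w" "of_real (2 * Re (G w))"] pos[OF w]
    by (intro mult_left_mono) (simp_all del: of_real_mult)
  finally show ?thesis
    by (simp add: algebra_simps)
qed

text \<open>Adding \<open>e / 2\<close> to \<open>G\<close> makes the real part strictly positive;
  then \<open>e\<close> tends to \<open>0\<close>. The weak inequality is the form that the Julia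
  inequality supplies for the displacements \<open>F h\<close> below.\<close>

lemma Harnack_norm:
  assumes G: "G holomorphic_on unit_disk" and nonneg: "\<And>z. norm z < 1 \<Longrightarrow> Re (G z) \<ge> 0"
    and z: "norm z < 1" and w: "norm w < 1"
  shows "(1 - pdist z w) * norm (G z - G w) \<le> 2 * pdist z w * Re (G w)"
proof (rule field_le_epsilon)
  fix e :: real assume e: "e > 0"
  have "(1 - pdist z w) * norm ((G z + of_real (e/2)) - (G w + of_real (e/2)))
      \<le> 2 * pdist z w * Re (G w + of_real (e/2))"
    by (rule Harnack_aux) (use nonneg e z w in \<open>auto intro!: holomorphic_intros G add_nonneg_pos\<close>)
  also have "\<dots> = 2 * pdist z w * Re (G w) + pdist z w * e"
    by (simp add: algebra_simps)
  also have "\<dots> \<le> 2 * pdist z w * Re (G w) + e"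
    using pdist_lt_1[OF z w] e by simp
  finally show "(1 - pdist z w) * norm (G z - G w) \<le> 2 * pdist z w * Re (G w) + e" by simp
qed

lemma Harnack_Re:
  assumes G: "G holomorphic_on unit_disk" and nonneg: "\<And>z. norm z < 1 \<Longrightarrow> Re (G z) \<ge> 0"
    and z: "norm z < 1" and w: "norm w < 1"
  shows "(1 - pdist z w) * Re (G w) \<le> (1 + pdist z w) * Re (G z)"
proof -
  have "Re (G w) - Re (G z) \<le> norm (G w - G z)"
    using complex_Re_le_cmod[of "G w - G z"] by simp
  then have "(1 - pdist z w) * (Re (G w) - Re (G z)) \<le> (1 - pdist z w) * norm (G w - G z)"
    using pdist_lt_1[OF z w] by (intro mult_left_mono) auto
  also have "\<dots> \<le> 2 * pdist z w * Re (G z)"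
    using Harnack_norm[OF G nonneg w z] by (simp add: pdist_commute)
  finally show ?thesis by (simp add: algebra_simps)
qed

section \<open>Lower bound for the hyperbolic distance\<close>

text \<open>The holomorphic function \<open>F = - Ln (1 - e m) / 2\<close>, with \<open>m\<close> the Moebius transformation sending
  \<open>z\<close> to \<open>0\<close> and \<open>e\<close> a rotation making \<open>e m w\<close> nonnegative, satisfies \<open>\<bar>F'\<bar> \<le> hyp_density\<close>.\<close>
lemma hyp_dist_ge:
  assumes z: "norm z < 1" and w: "norm w < 1"
  shows "hyp_dist z w \<ge> - ln (1 - pdist z w) / 2"
  unfolding hyp_dist_def
proof (rule cINF_greatest)
  \<comment> \<open>The segment witnesses that the infimum runs over a nonempty set.\<close>
  have "linepath z w \<in> smooth_curves_joining z w"
  proof -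
    have "linepath z w C1_differentiable_on {0..1}"
      unfolding linepath_def
      by (intro C1_differentiable_on_add C1_differentiable_on_scaleR) (auto intro: C1_differentiable_on_of_real)
    moreover have "linepath z w \<in> {0..1} \<rightarrow> unit_disk"
      using convex_ball[of "0::complex" 1] z w linepath_in_convex_hull
      by (metis (no_types, lifting) Pi_I closed_segment_subset linepath_in_path mem_ball_0 subsetD)
    ultimately show ?thesis
      by (auto simp: smooth_curves_joining_def linepath_def)
  qed
  then show "smooth_curves_joining z w \<noteq> {}" by blast
next
  fix \<eta> assume "\<eta> \<in> smooth_curves_joining z w"
  then have C1: "\<eta> C1_differentiable_on {0..1}" and im: "\<And>t. t \<in> {0..1} \<Longrightarrow> norm (\<eta> t) < 1"
    and ends: "\<eta> 0 = z" "\<eta> 1 = w"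
    by (auto simp: smooth_curves_joining_def Pi_iff)
  from C1 obtain D where D: "\<And>t. t \<in> {0..1} \<Longrightarrow> (\<eta> has_vector_derivative D t) (at t)"
    and contD: "continuous_on {0..1} D"
    unfolding C1_differentiable_on_def by blast
  define m where "m = Moebius_function 0 z"
  define e where "e = (if m w = 0 then 1 else cnj (sgn (m w)))"
  have e1: "norm e = 1" by (auto simp: e_def norm_sgn)
  have emw: "e * m w = of_real (pdist w z)"
  proof (cases "m w = 0")
    case False
    have "cnj (m w) * m w = of_real ((norm (m w))\<^sup>2)"
      by (metis complex_norm_square mult.commute)
    with False show ?thesis
      by (simp add: e_def m_def pdist_eq_Moebius sgn_eq power2_eq_square)
  qed (simp add: m_def pdist_eq_Moebius)
  define F where "F = (\<lambda>u. - 1 / 2 * Ln (1 - e * m u))"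
  define m' where "m' = (\<lambda>u. (1 - (norm z)\<^sup>2) / (1 - cnj z * u)\<^sup>2)"
  define F' where "F' = (\<lambda>u. - 1 / 2 * ((- (e * m' u)) / (1 - e * m u)))"
  have nz: "1 - cnj z * u \<noteq> 0" if "norm u < 1" for u
    using one_minus_cnj_pos[OF z that] by auto
  have mlt: "norm (m u) < 1" if "norm u < 1" for u
    using that z by (simp add: m_def Moebius_function_norm_lt_1)
  have zz: "of_real (norm z) * of_real (norm z) = z * cnj z"
    by (metis complex_norm_square of_real_mult power2_eq_square)
  have dm: "(m has_field_derivative m' u) (at u)" if "norm u < 1" for u
    unfolding m_def Moebius_function_simple[abs_def] m'_def
    by (rule derivative_eq_intros refl | use nz[OF that] in force)+
       (use nz[OF that] zz in \<open>simp add: field_simps power2_eq_square\<close>)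
  have dF: "(F has_field_derivative F' u) (at u)" if "norm u < 1" for u
  proof -
    have "Re (e * m u) < 1"
      using complex_Re_le_cmod[of "e * m u"] mlt[OF that] e1 by (simp add: norm_mult)
    then have "1 - e * m u \<notin> \<real>\<^sub>\<le>\<^sub>0"
      by (auto simp: complex_nonpos_Reals_iff)
    then have "((\<lambda>u. Ln (1 - e * m u)) has_field_derivative (- (e * m' u)) / (1 - e * m u)) (at u)"
      by (auto intro!: derivative_eq_intros dm that simp: divide_inverse)
    from DERIV_cmult[OF this, of "- 1 / 2"] show ?thesis
      unfolding F_def F'_def .
  qed
  have F'_le: "norm (F' u) \<le> hyp_density u" if u: "norm u < 1" for u
  proof -
    have a: "1 - norm (m u) \<le> norm (1 - e * m u)"
      using norm_triangle_ineq2[of 1 "e * m u"] e1 by (simp add: norm_mult)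
    \<comment> \<open>This is where the factor \<open>1 / 2\<close> in \<open>F\<close> pays off:
      with \<open>a\<close>, the number \<open>2 * norm (1 - e * m u)\<close> dominates
      \<open>1 - (norm (m u))\<^sup>2\<close>.\<close>
    have b: "1 - (norm (m u))\<^sup>2 \<le> 2 * (1 - norm (m u))"
      using sum_power2_ge_zero[of "norm (m u) - 1" 0] by (simp add: power2_eq_square algebra_simps)
    have p: "1 - (norm (m u))\<^sup>2 > 0"
      using mlt[OF u] by (simp add: abs_square_less_1)
    have c: "1 - (norm (m u))\<^sup>2 = (1 - (norm u)\<^sup>2) * (1 - (norm z)\<^sup>2) / (norm (1 - cnj z * u))\<^sup>2"
      using one_minus_pdist_sq[OF u z] by (simp add: m_def pdist_eq_Moebius)
    have z1: "1 - (norm z)\<^sup>2 > 0" and u1: "1 - (norm u)\<^sup>2 > 0"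
      using z u by (simp_all add: abs_square_less_1)
    have "norm (F' u) = norm (m' u) / (2 * norm (1 - e * m u))"
      unfolding F'_def norm_mult norm_divide norm_minus_cancel e1 by simp
    also have "\<dots> \<le> norm (m' u) / (1 - (norm (m u))\<^sup>2)"
      using a b p mlt[OF u] by (intro divide_left_mono mult_pos_pos) auto
    also have "norm (m' u) = (1 - (norm z)\<^sup>2) / (norm (1 - cnj z * u))\<^sup>2"
    proof -
      have "m' u = of_real (1 - (norm z)\<^sup>2) / (1 - cnj z * u)\<^sup>2" by (simp add: m'_def)
      then show ?thesis using z1 by (simp add: norm_divide norm_power del: of_real_diff)
    qed
    \<comment> \<open>Invariance of the hyperbolic density under the disk automorphism
      \<open>m\<close>.\<close>
    also have "\<dots> / (1 - (norm (m u))\<^sup>2) = hyp_density u"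
    proof -
      have "a / n / (b * a / n) = 1 / b" if "a > 0" "n > 0" for a b n :: real
        using that by (simp add: divide_simps)
      then show ?thesis
        unfolding c hyp_density_def using nz[OF u] z1 by simp
    qed
    finally show ?thesis .
  qed
  have ceta: "continuous_on {0..1} \<eta>"
    using D by (meson continuous_at_imp_continuous_on has_vector_derivative_continuous)
  have vd: "vector_derivative \<eta> (at t within {0..1}) = D t" if "t \<in> {0..1}" for t
    using vector_derivative_at_within_ivl[OF D[OF that]] that by auto
  have I: "((\<lambda>t. D t * F' (\<eta> t)) has_integral (F (\<eta> 1) - F (\<eta> 0))) {0..1}"
  proof (rule fundamental_theorem_of_calculus)
    fix t :: real assume t: "t \<in> {0..1}"
    have "((F \<circ> \<eta>) has_vector_derivative D t * F' (\<eta> t)) (at t)"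
      using field_vector_diff_chain_at[OF D[OF t] dF[OF im[OF t]]] by simp
    then show "((\<lambda>t. F (\<eta> t)) has_vector_derivative D t * F' (\<eta> t)) (at t within {0..1})"
      by (simp add: o_def has_vector_derivative_at_within)
  qed simp
  have hc: "continuous_on {0..1} (\<lambda>t. hyp_density (\<eta> t) * norm (D t))"
    unfolding hyp_density_def
    by (intro continuous_intros ceta contD) (use im in \<open>force simp: abs_square_eq_1\<close>)
  have "norm (F w - F z) = norm (integral {0..1} (\<lambda>t. D t * F' (\<eta> t)))"
    using integral_unique[OF I] ends by simp
  also have "\<dots> \<le> integral {0..1} (\<lambda>t. hyp_density (\<eta> t) * norm (D t))"
  proof (rule integral_norm_bound_integral)
    show "(\<lambda>t. D t * F' (\<eta> t)) integrable_on {0..1}" using I by blast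
    show "(\<lambda>t. hyp_density (\<eta> t) * norm (D t)) integrable_on {0..1}"
      by (intro integrable_continuous_interval hc)
    show "norm (D t * F' (\<eta> t)) \<le> hyp_density (\<eta> t) * norm (D t)" if "t \<in> {0..1}" for t
      using mult_left_mono[OF F'_le[OF im[OF that]], of "norm (D t)"] by (simp add: norm_mult mult.commute)
  qed
  also have "\<dots> = hyp_length \<eta> 0 1"
    unfolding hyp_length_def by (intro integral_cong) (simp add: vd)
  also have "F w - F z = of_real (- ln (1 - pdist w z) / 2)"
  proof -
    have "F z = 0" by (simp add: F_def m_def Moebius_function_eq_zero)
    moreover have "Ln (1 - e * m w) = of_real (ln (1 - pdist w z))"
      using pdist_lt_1[OF w z] Ln_of_real[of "1 - pdist w z"] by (simp add: emw)
    ultimately show ?thesis by (simp add: F_def)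
  qed
  finally have "\<bar>- ln (1 - pdist w z) / 2\<bar> \<le> hyp_length \<eta> 0 1" by (simp only: norm_of_real)
  then show "- ln (1 - pdist z w) / 2 \<le> hyp_length \<eta> 0 1"
    by (simp add: pdist_commute)
qed

section \<open>Denjoy-Wolff point\<close>

text \<open>The real part of the Cayley transform sending \<open>\<tau>\<close> to infinity; its superlevel sets are the
  horodisks at \<open>\<tau>\<close>.\<close>
definition horo :: "complex \<Rightarrow> complex \<Rightarrow> real" where
  "horo \<tau> z = (1 - (norm z)\<^sup>2) / (norm (\<tau> - z))\<^sup>2"

definition cayley :: "complex \<Rightarrow> complex \<Rightarrow> complex" where
  "cayley \<tau> z = (\<tau> + z) / (\<tau> - z)"

lemma Re_cayley:
  assumes "norm \<tau> = 1" shows "Re (cayley \<tau> z) = horo \<tau> z"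
proof -
  have "Re ((\<tau> + z) * cnj (\<tau> - z)) = (norm \<tau>)\<^sup>2 - (norm z)\<^sup>2"
    unfolding cmod_power2 by (simp add: power2_eq_square algebra_simps)
  then show ?thesis
    using assms unfolding cayley_def horo_def
    by (subst complex_div_cnj) (simp flip: of_real_power)
qed

lemma horo_pos:
  assumes "norm \<tau> = 1" "norm z < 1" shows "horo \<tau> z > 0"
proof -
  have "\<tau> \<noteq> z" using assms by auto
  then show ?thesis
    using assms by (simp add: horo_def abs_square_less_1)
qed

lemma cayley_holomorphic:
  assumes "norm \<tau> = 1" shows "cayley \<tau> holomorphic_on unit_disk"
  unfolding cayley_def[abs_def] by (intro holomorphic_intros) (use assms in auto)

lemma cayley_diff:
  assumes "z \<noteq> \<tau>" "w \<noteq> \<tau>"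
  shows "cayley \<tau> z - cayley \<tau> w = 2 * \<tau> * (z - w) / ((\<tau> - z) * (\<tau> - w))"
  using assms by (simp add: cayley_def field_simps)

lemma disk_semigroupD:
  assumes "disk_semigroup \<phi>" "t \<ge> 0"
  shows "\<phi> t holomorphic_on unit_disk" "\<phi> t \<in> unit_disk \<rightarrow> unit_disk"
    "norm z < 1 \<Longrightarrow> norm (\<phi> t z) < 1"
    "norm z < 1 \<Longrightarrow> s \<ge> 0 \<Longrightarrow> \<phi> (t + s) z = \<phi> t (\<phi> s z)"
    "norm z < 1 \<Longrightarrow> ((\<lambda>s. \<phi> s z) \<longlongrightarrow> \<phi> t z) (at t within {0..})"
  using assms unfolding disk_semigroup_def by (auto simp: Pi_iff)

lemma continuous_on_semigroup:
  assumes "disk_semigroup \<phi>" "norm z < 1"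
  shows "continuous_on {0..} (\<lambda>s. \<phi> s z)"
  unfolding continuous_on_def using disk_semigroupD(5)[OF assms(1) _ assms(2)] by auto

text \<open>The first part cancels the factor \<open>e\<close>, later
  \<open>1 - (norm (w n))\<^sup>2\<close>, before it degenerates to \<open>0\<close> in the limit;
  the second returns to quotients afterwards.\<close>

lemma cross_mult_le:
  fixes a b e s t :: real
  assumes "s > 0" "t > 0"
  shows "e > 0 \<Longrightarrow> a * e / s \<le> b * e / t \<Longrightarrow> a * t \<le> b * s"
    and "a * t \<le> b * s \<Longrightarrow> a / s \<le> b / t"
proof -
  assume e: "e > 0" and le: "a * e / s \<le> b * e / t"
  from le have "(a / s) * e \<le> (b / t) * e" by simp
  with e have "a / s \<le> b / t" by (simp only: mult_le_cancel_right_pos)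
  then have "a / s * (s * t) \<le> b / t * (s * t)"
    using assms by (intro mult_right_mono) auto
  then show "a * t \<le> b * s" using assms by simp
next
  assume "a * t \<le> b * s"
  then show "a / s \<le> b / t"
    using assms by (simp add: frac_le_eq divide_le_0_iff)
qed

text \<open>\<open>\<tau>\<close> is a limit of fixed points \<open>w\<^sub>n\<close> of \<open>r\<^sub>n f\<close> with \<open>r\<^sub>n \<rightarrow> 1\<close>: the Schwarz-Pick inequality
  at \<open>w\<^sub>n\<close> becomes Julia's inequality at \<open>\<tau>\<close> in the limit.\<close>
lemma Wolff:
  assumes f: "f holomorphic_on unit_disk" and im: "f \<in> unit_disk \<rightarrow> unit_disk"
    and nofix: "\<And>z. norm z < 1 \<Longrightarrow> f z \<noteq> z"
  shows "\<exists>\<tau>. norm \<tau> = 1 \<and> (\<forall>z\<in>unit_disk. horo \<tau> z \<le> horo \<tau> (f z))"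
proof -
  have fim: "norm (f z) < 1" if "norm z < 1" for z using im that by (auto simp: Pi_iff)
  define r where "r = (\<lambda>n. 1 - 1 / (real n + 2))"
  have r: "0 < r n" "r n < 1" for n by (auto simp: r_def field_simps)
  have "r n = 1 + - inverse (real (Suc (Suc n)))" for n
    by (simp add: r_def field_simps)
  then have rlim: "r \<longlonglongrightarrow> 1"
    using LIMSEQ_Suc[OF LIMSEQ_inverse_real_of_nat_add_minus[of 1]] by presburger
  \<comment> \<open>Brouwer's theorem on the closed disk of radius \<open>r n\<close>, which
    \<open>r n * f\<close> maps into itself.\<close>
  have "\<exists>w. norm w < 1 \<and> of_real (r n) * f w = w" for n
  proof -
    have sub: "cball 0 (r n) \<subseteq> unit_disk" using r[of n] by auto
    have "continuous_on (cball 0 (r n)) (\<lambda>w. of_real (r n) * f w)"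
      by (intro continuous_intros holomorphic_on_imp_continuous_on holomorphic_on_subset[OF f] sub)
    moreover have "(\<lambda>w. of_real (r n) * f w) \<in> cball 0 (r n) \<rightarrow> cball 0 (r n)"
      using sub r[of n] fim by (auto simp: norm_mult mult_left_le less_imp_le subset_iff)
    ultimately obtain w where "w \<in> cball 0 (r n)" "of_real (r n) * f w = w"
      using brouwer_ball[OF r(1)] by metis
    then show ?thesis using r(2)[of n] by (intro exI[of _ w]) auto
  qed
  then obtain w where w: "\<And>n. norm (w n) < 1" "\<And>n. of_real (r n) * f (w n) = w n" by metis
  have "w n \<in> cball 0 1" for n using w(1)[of n] by (simp add: less_imp_le)
  then obtain \<tau> k where \<tau>: "\<tau> \<in> cball 0 1" and k: "strict_mono k" "(w \<circ> k) \<longlonglongrightarrow> \<tau>"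
    using compact_imp_seq_compact[OF compact_cball, of "0::complex" 1] unfolding seq_compact_def by metis
  have rk: "(\<lambda>n. r (k n)) \<longlonglongrightarrow> 1"
    using LIMSEQ_subseq_LIMSEQ[OF rlim k(1)] by (simp add: o_def)
  have wk: "(\<lambda>n. w (k n)) \<longlonglongrightarrow> \<tau>" using k(2) by (simp add: o_def)
  \<comment> \<open>An interior limit point would be a fixed point of \<open>f\<close> by
    continuity.\<close>
  have n1: "norm \<tau> = 1"
  proof (rule ccontr)
    assume "norm \<tau> \<noteq> 1"
    with \<tau> have t1: "norm \<tau> < 1" by simp
    then have "isCont f \<tau>"
      using f by (meson continuous_on_eq_continuous_at holomorphic_on_imp_continuous_on mem_ball_0 open_ball)
    then have "(\<lambda>n. f (w (k n))) \<longlonglongrightarrow> f \<tau>"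
      using wk isCont_tendsto_compose by blast
    from tendsto_mult[OF tendsto_of_real[OF rk] this]
    have "(\<lambda>n. w (k n)) \<longlonglongrightarrow> f \<tau>" using w(2) by simp
    with wk have "f \<tau> = \<tau>" using LIMSEQ_unique by blast
    with nofix t1 show False by blast
  qed
  have "horo \<tau> z \<le> horo \<tau> (f z)" if z: "norm z < 1" for z
  proof -
    have ineq: "(1 - (norm z)\<^sup>2) * (norm (1 - cnj (w n) * (of_real (r n) * f z)))\<^sup>2
          \<le> (1 - (norm (of_real (r n) * f z))\<^sup>2) * (norm (1 - cnj (w n) * z))\<^sup>2" for n
    proof -
      define g where "g = (\<lambda>z. of_real (r n) * f z)"
      have g1: "norm (g z) < 1" if "norm z < 1" for z
        using mult_strict_mono[of "r n" 1 "norm (f z)" 1] fim[OF that] r[of n] by (simp add: g_def norm_mult)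
      have "pdist (g z) (g (w n)) \<le> pdist z (w n)"
        by (rule Schwarz_Pick) (use g1 z w in \<open>auto simp: g_def intro!: holomorphic_intros f\<close>)
      moreover have "g (w n) = w n" using w(2) by (simp add: g_def)
      ultimately have "1 - (pdist z (w n))\<^sup>2 \<le> 1 - (pdist (g z) (w n))\<^sup>2"
        by (simp add: power_mono)
      then have "(1 - (norm z)\<^sup>2) * (1 - (norm (w n))\<^sup>2) / (norm (1 - cnj (w n) * z))\<^sup>2
          \<le> (1 - (norm (g z))\<^sup>2) * (1 - (norm (w n))\<^sup>2) / (norm (1 - cnj (w n) * g z))\<^sup>2"
        by (simp only: one_minus_pdist_sq[OF z w(1)] one_minus_pdist_sq[OF g1[OF z] w(1)])
      moreover have "1 - (norm (w n))\<^sup>2 > 0" using w(1) by (simp add: abs_square_less_1)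
      moreover have "norm (1 - cnj (w n) * z) > 0" "norm (1 - cnj (w n) * g z) > 0"
        using one_minus_cnj_pos w(1) z g1 by blast+
      ultimately show ?thesis
        unfolding g_def by (intro cross_mult_le(1)) (simp_all only: zero_less_power)
    qed
    have "(1 - (norm z)\<^sup>2) * (norm (1 - cnj \<tau> * (of_real 1 * f z)))\<^sup>2
          \<le> (1 - (norm (of_real 1 * f z))\<^sup>2) * (norm (1 - cnj \<tau> * z))\<^sup>2"
    proof (rule LIMSEQ_le)
      show "(\<lambda>n. (1 - (norm z)\<^sup>2) * (norm (1 - cnj (w (k n)) * (of_real (r (k n)) * f z)))\<^sup>2)
          \<longlonglongrightarrow> (1 - (norm z)\<^sup>2) * (norm (1 - cnj \<tau> * (of_real 1 * f z)))\<^sup>2"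
        by (intro tendsto_intros wk rk)
      show "(\<lambda>n. (1 - (norm (of_real (r (k n)) * f z))\<^sup>2) * (norm (1 - cnj (w (k n)) * z))\<^sup>2)
          \<longlonglongrightarrow> (1 - (norm (of_real 1 * f z))\<^sup>2) * (norm (1 - cnj \<tau> * z))\<^sup>2"
        by (intro tendsto_intros wk rk)
      show "\<exists>N. \<forall>n\<ge>N. (1 - (norm z)\<^sup>2) * (norm (1 - cnj (w (k n)) * (of_real (r (k n)) * f z)))\<^sup>2
          \<le> (1 - (norm (of_real (r (k n)) * f z))\<^sup>2) * (norm (1 - cnj (w (k n)) * z))\<^sup>2"
        by (intro exI allI impI ineq)
    qed
    then have "(1 - (norm z)\<^sup>2) * (norm (1 - cnj \<tau> * f z))\<^sup>2
          \<le> (1 - (norm (f z))\<^sup>2) * (norm (1 - cnj \<tau> * z))\<^sup>2"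
      by (simp only: of_real_1 mult_1)
    moreover have nrm: "norm (1 - cnj \<tau> * u) = norm (\<tau> - u)" for u
    proof -
      have "\<tau> * cnj \<tau> = 1"
        by (metis complex_norm_square n1 of_real_1 one_power2)
      then have "\<tau> * (1 - cnj \<tau> * u) = \<tau> - u"
        by (simp add: right_diff_distrib flip: mult.assoc)
      then show ?thesis using n1 by (metis mult_1 norm_mult)
    qed
    moreover have "(norm (\<tau> - z))\<^sup>2 > 0" "(norm (\<tau> - f z))\<^sup>2 > 0"
      using n1 z fim[OF z] by auto
    ultimately show ?thesis
      unfolding horo_def nrm by (intro cross_mult_le(2))
  qed
  then show ?thesis using n1 by (intro exI[of _ \<tau>]) simp
qed

text \<open>For fixed \<open>z\<close> in the disk, \<open>horo \<tau> z\<close> is continuous in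
  \<tau> on the circle, so each inequality defines a closed set. Compactness is needed for a nested
  intersection over a sequence of times.\<close>

lemma compact_horo_increasing:
  assumes "f \<in> unit_disk \<rightarrow> unit_disk"
  shows "compact {\<tau>. norm \<tau> = 1 \<and> (\<forall>z\<in>unit_disk. horo \<tau> z \<le> horo \<tau> (f z))}" (is "compact ?S")
proof -
  have "?S = sphere 0 1 \<inter> (\<Inter>z\<in>unit_disk. {\<tau>\<in>sphere 0 1. horo \<tau> z \<le> horo \<tau> (f z)})"
    by auto
  moreover have "closed {\<tau>\<in>sphere 0 1. horo \<tau> z \<le> horo \<tau> (f z)}" if "z \<in> unit_disk" for z
    unfolding horo_def
  proof (intro continuous_on_closed_Collect_le continuous_intros)
    show "\<forall>\<tau>\<in>sphere 0 1. (norm (\<tau> - z))\<^sup>2 \<noteq> 0" using that by auto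
    show "\<forall>\<tau>\<in>sphere 0 1. (norm (\<tau> - f z))\<^sup>2 \<noteq> 0" using funcset_mem[OF assms that] by auto
  qed auto
  ultimately show ?thesis
    by (auto intro!: compact_Int_closed)
qed

text \<open>\<open>Wolff\<close> gives a point for one map only. The admissible points for the times
  \<open>T / 2 ^ k\<close> form decreasing nonempty compact sets; a common point serves all
  multiples of these times, and continuity in \<open>t\<close> extends this to every
  \<open>t \<ge> 0\<close>.\<close>

lemma Denjoy_Wolff_point:
  assumes \<phi>: "disk_semigroup \<phi>" and ne: "non_elliptic \<phi>"
  obtains \<tau> where "norm \<tau> = 1"
    "\<And>t z. t \<ge> 0 \<Longrightarrow> norm z < 1 \<Longrightarrow> horo \<tau> z \<le> horo \<tau> (\<phi> t z)"
proof -
  from ne obtain T where T: "T > 0" and nofix: "\<And>z. norm z < 1 \<Longrightarrow> \<phi> T z \<noteq> z"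
    by (auto simp: non_elliptic_def)
  define P where "P = (\<lambda>\<tau> t. \<forall>z\<in>unit_disk. horo \<tau> z \<le> horo \<tau> (\<phi> t z))"
  define h where "h = (\<lambda>k::nat. T / 2 ^ k)"
  have h: "h k > 0" for k using T by (simp add: h_def)
  have P_add: "P \<tau> (s + t)" if "P \<tau> s" "P \<tau> t" "s \<ge> 0" "t \<ge> 0" for \<tau> s t
    unfolding P_def
  proof
    fix z :: complex assume "z \<in> unit_disk"
    then have z: "norm z < 1" by simp
    have "horo \<tau> z \<le> horo \<tau> (\<phi> t z)" using that(2) z by (auto simp: P_def)
    also have "\<dots> \<le> horo \<tau> (\<phi> s (\<phi> t z))"
      using that disk_semigroupD(3)[OF \<phi> that(4) z] by (auto simp: P_def)
    finally show "horo \<tau> z \<le> horo \<tau> (\<phi> (s + t) z)"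
      using disk_semigroupD(4)[OF \<phi> that(3) z that(4)] by simp
  qed
  define S where "S = (\<lambda>k. {\<tau>. norm \<tau> = 1 \<and> P \<tau> (h k)})"
  have dbl: "h k = h (Suc k) + h (Suc k)" for k by (simp add: h_def)
  \<comment> \<open>Iterating shows that a fixed point at time \<open>h k\<close> is also one at
    time \<open>T\<close>; hence \<open>Wolff\<close> applies at every \<open>h k\<close>.\<close>
  have fix_h: "\<phi> T z = z" if "\<phi> (h k) z = z" "norm z < 1" for k z
    using that(1)
  proof (induction k)
    case (Suc k)
    have "\<phi> (h k) z = \<phi> (h (Suc k)) (\<phi> (h (Suc k)) z)"
      unfolding dbl[of k] by (rule disk_semigroupD(4)[OF \<phi> less_imp_le[OF h] that(2) less_imp_le[OF h]])
    with Suc show ?case by simp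
  qed (simp add: h_def)
  have "\<Inter>(range S) \<noteq> {}"
  proof (rule compact_nest)
    show "compact (S k)" for k
      unfolding S_def P_def by (rule compact_horo_increasing) (use disk_semigroupD(2)[OF \<phi>] h in \<open>simp add: less_imp_le\<close>)
    show "S k \<noteq> {}" for k
    proof -
      have "\<exists>\<tau>. norm \<tau> = 1 \<and> (\<forall>z\<in>unit_disk. horo \<tau> z \<le> horo \<tau> (\<phi> (h k) z))"
        by (rule Wolff) (use disk_semigroupD(1,2)[OF \<phi>] h fix_h nofix in \<open>auto simp: less_imp_le\<close>)
      then show ?thesis by (auto simp: S_def P_def)
    qed
    have "decseq S"
    proof (rule decseq_SucI)
      show "S (Suc k) \<subseteq> S k" for k
        unfolding S_def dbl[of k] using P_add h by (blast intro: less_imp_le)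
    qed
    then show "S n \<subseteq> S m" if "m \<le> n" for m n using that by (simp add: decseqD)
  qed
  then obtain \<tau> where \<tau>: "norm \<tau> = 1" "\<And>k. P \<tau> (h k)" by (auto simp: S_def)
  have P_mult: "P \<tau> (real m * h k)" for m k
  proof (induction m)
    case 0 show ?case using \<phi> by (auto simp: P_def disk_semigroup_def)
  next
    case (Suc m)
    have "real (Suc m) * h k = real m * h k + h k" by (simp add: algebra_simps)
    then show ?case using P_add[OF Suc \<tau>(2)[of k]] h[of k] by (simp add: less_imp_le)
  qed
  have "horo \<tau> z \<le> horo \<tau> (\<phi> t z)" if t: "t \<ge> 0" and z: "norm z < 1" for t z
  proof -
    \<comment> \<open>\<open>m k * h k\<close> is the largest multiple of \<open>h k\<close> not
      exceeding \<open>t\<close>, so it converges to \<open>t\<close>.\<close>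
    define m where "m = (\<lambda>k. nat \<lfloor>t / h k\<rfloor>)"
    have m: "real (m k) \<le> t / h k" "t / h k < real (m k) + 1" for k
      using t h[of k] by (simp_all add: m_def)
    have b: "real (m k) * h k \<le> t" "t - h k \<le> real (m k) * h k" for k
      using m[of k] h[of k] by (simp_all add: field_simps)
    have h0: "h \<longlonglongrightarrow> 0"
    proof -
      have "(\<lambda>k. T * (1/2) ^ k) \<longlonglongrightarrow> T * 0"
        by (intro tendsto_intros LIMSEQ_power_zero) auto
      then show ?thesis by (simp add: h_def[abs_def] power_divide)
    qed
    have lim: "(\<lambda>k. real (m k) * h k) \<longlonglongrightarrow> t"
    proof (rule tendsto_sandwich)
      show "(\<lambda>k. t - h k) \<longlonglongrightarrow> t" using tendsto_diff[OF tendsto_const h0, of t] by simp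
    qed (use b in auto)
    have "(\<lambda>k. \<phi> (real (m k) * h k) z) \<longlonglongrightarrow> \<phi> t z"
      using continuous_on_tendsto_compose[OF continuous_on_semigroup[OF \<phi> z] lim] t h
      by (simp add: less_imp_le)
    then have "(\<lambda>k. horo \<tau> (\<phi> (real (m k) * h k) z)) \<longlonglongrightarrow> horo \<tau> (\<phi> t z)"
      unfolding horo_def using \<tau>(1) disk_semigroupD(3)[OF \<phi> t z] by (intro tendsto_intros) auto
    then show ?thesis
      by (rule LIMSEQ_le_const) (use P_mult z in \<open>auto simp: P_def\<close>)
  qed
  with \<tau>(1) show ?thesis using that by blast
qed

section \<open>Decay of the orbit\<close>

text \<open>No cancellation can occur in the sum, because all terms have real part at least
  \<open>c * Re g\<close>. This bounds \<open>n * Re g\<close> by \<open>norm S / c\<close>, and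
  \<open>n * g\<close> differs from \<open>S\<close> by at most \<open>C * n * Re g\<close>.\<close>

lemma norm_le_norm_sum:
  fixes u :: "nat \<Rightarrow> complex"
  assumes c: "c > 0" and C: "C \<ge> 0"
    and dist: "\<And>k. k < n \<Longrightarrow> norm (u k - g) \<le> C * Re g"
    and Re: "\<And>k. k < n \<Longrightarrow> c * Re g \<le> Re (u k)"
  shows "real n * norm g \<le> (1 + C / c) * norm (\<Sum>k<n. u k)"
proof -
  define S where "S = (\<Sum>k<n. u k)"
  have "real n * (c * Re g) = (\<Sum>k<n. c * Re g)" by simp
  also have "\<dots> \<le> (\<Sum>k<n. Re (u k))" by (intro sum_mono Re) auto
  also have "\<dots> = Re S" by (simp add: S_def)
  also have "\<dots> \<le> norm S" by (rule complex_Re_le_cmod)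
  finally have "real n * Re g \<le> norm S / c" using c by (simp add: field_simps)
  then have a: "C * (real n * Re g) \<le> C * (norm S / c)" using C by (intro mult_left_mono)
  have "of_nat n * g = S - (\<Sum>k<n. u k - g)"
    by (simp add: S_def sum_subtractf)
  then have "real n * norm g = norm (S - (\<Sum>k<n. u k - g))"
    by (metis norm_mult norm_of_nat)
  also have "\<dots> \<le> norm S + (\<Sum>k<n. norm (u k - g))"
    by (rule order_trans[OF norm_triangle_ineq4 add_left_mono[OF norm_sum]])
  also have "(\<Sum>k<n. norm (u k - g)) \<le> (\<Sum>k<n. C * Re g)" by (intro sum_mono dist) auto
  also have "\<dots> = C * (real n * Re g)" by simp
  also note a
  finally show ?thesis by (simp add: S_def algebra_simps)
qed

text \<open>Non-ellipticity enters through \<tau> and \<open>horo_increasing\<close>, which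
  \<open>Denjoy_Wolff_point\<close> provides.\<close>

locale nontangential_orbit =
  fixes \<phi> :: "real \<Rightarrow> complex \<Rightarrow> complex" and \<gamma> :: "real \<Rightarrow> complex" and \<sigma> \<tau> :: complex
  assumes semigroup: "disk_semigroup \<phi>" and regular: "regular_backward_orbit \<phi> \<gamma>"
    and norm_\<sigma>: "norm \<sigma> = 1" and nontangential: "converges_non_tangentially \<gamma> \<sigma>"
    and norm_\<tau>: "norm \<tau> = 1"
    and horo_increasing: "\<And>t z. t \<ge> 0 \<Longrightarrow> norm z < 1 \<Longrightarrow> horo \<tau> z \<le> horo \<tau> (\<phi> t z)"
begin

lemma orbit_in_disk: "t \<ge> 0 \<Longrightarrow> norm (\<gamma> t) < 1"
  and continuous_orbit: "continuous_on {0..} \<gamma>"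
  using regular by (auto simp: regular_backward_orbit_def backward_orbit_def Pi_iff)

lemma orbit_back:
  assumes "0 \<le> s" "0 \<le> t" shows "\<phi> s (\<gamma> (t + s)) = \<gamma> t"
proof (cases "t + s > 0")
  case True
  then show ?thesis
    using assms regular by (auto simp: regular_backward_orbit_def backward_orbit_def)
next
  case False
  then have "s = 0" "t = 0" using assms by auto
  then show ?thesis
    using semigroup orbit_in_disk[of 0] by (simp add: disk_semigroup_def)
qed

text \<open>\<open>\<phi> s\<close> shifts the orbit back by \<open>s\<close> and is a contraction
  by Schwarz-Pick.\<close>

lemma pdist_orbit_increasing:
  assumes "0 \<le> u" "0 \<le> v" "0 \<le> s"
  shows "pdist (\<gamma> u) (\<gamma> v) \<le> pdist (\<gamma> (u + s)) (\<gamma> (v + s))"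
  using Schwarz_Pick[OF disk_semigroupD(1,2)[OF semigroup assms(3)], of "\<gamma> (u + s)" "\<gamma> (v + s)"]
  by (simp add: orbit_back orbit_in_disk assms)

lemma horo_orbit_decreasing:
  assumes "0 \<le> s" "s \<le> t" shows "horo \<tau> (\<gamma> t) \<le> horo \<tau> (\<gamma> s)"
  using horo_increasing[of "t - s" "\<gamma> t"] orbit_back[of "t - s" s] orbit_in_disk[of t] assms by simp

lemma orbit_tendsto: "(\<gamma> \<longlongrightarrow> \<sigma>) at_top"
  using nontangential by (simp add: converges_non_tangentially_def)

lemma stolz:
  obtains M T where "M > 1" "T \<ge> 0" "\<And>t. t \<ge> T \<Longrightarrow> norm (\<sigma> - \<gamma> t) < M * (1 - norm (\<gamma> t))"
proof -
  obtain M where M: "M > 1" and "\<forall>\<^sub>F t in at_top. norm (\<sigma> - \<gamma> t) < M * (1 - norm (\<gamma> t))"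
    using nontangential unfolding converges_non_tangentially_def stolz_angle_def
    by (auto simp: eventually_conj_iff)
  then obtain T where "\<And>t. t \<ge> T \<Longrightarrow> norm (\<sigma> - \<gamma> t) < M * (1 - norm (\<gamma> t))"
    by (auto simp: eventually_at_top_linorder)
  then show ?thesis using that[OF M, of "max T 0"] by auto
qed

text \<open>Otherwise \<open>horo \<tau>\<close> would blow up along the orbit in the Stolz angle, whereas it decreases.\<close>
lemma \<sigma>_neq_\<tau>: "\<sigma> \<noteq> \<tau>"
proof
  assume eq: "\<sigma> = \<tau>"
  obtain M T where M: "M > 1" and T: "T \<ge> 0"
    and st: "\<And>t. t \<ge> T \<Longrightarrow> norm (\<sigma> - \<gamma> t) < M * (1 - norm (\<gamma> t))"
    using stolz by metis
  define H where "H = horo \<tau> (\<gamma> 0)"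
  have H: "H > 0" using horo_pos[OF norm_\<tau> orbit_in_disk[of 0]] by (simp add: H_def)
  have "1 / (M * H) \<le> norm (\<sigma> - \<gamma> t)" if t: "t \<ge> T" for t
  proof -
    have t0: "t \<ge> 0" using t T by simp
    define d where "d = norm (\<sigma> - \<gamma> t)"
    have d: "d > 0" using orbit_in_disk[OF t0] norm_\<sigma> by (auto simp: d_def)
    have "d \<le> M * (1 - norm (\<gamma> t))" using st[OF t] by (simp add: d_def)
    also have "\<dots> \<le> M * (1 - (norm (\<gamma> t))\<^sup>2)"
      using M orbit_in_disk[OF t0] by (intro mult_left_mono) (auto simp: power2_eq_square mult_left_le)
    also have "1 - (norm (\<gamma> t))\<^sup>2 = horo \<tau> (\<gamma> t) * d\<^sup>2"
      using d by (simp add: horo_def eq d_def)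
    also have "\<dots> \<le> H * d\<^sup>2"
      unfolding H_def by (intro mult_right_mono horo_orbit_decreasing t0) auto
    \<comment> \<open>Cancelling \<open>d\<close> keeps the distance to \<sigma> away from
      \<open>0\<close>, against convergence.\<close>
    finally have "d * 1 \<le> d * (M * H * d)"
      using M by (simp add: power2_eq_square ac_simps)
    with d have "1 \<le> M * H * d" by (simp only: mult_le_cancel_left_pos)
    then show ?thesis using M H by (simp add: d_def field_simps)
  qed
  then have "\<forall>\<^sub>F t in at_top. 1 / (M * H) \<le> norm (\<sigma> - \<gamma> t)"
    unfolding eventually_at_top_linorder by blast
  moreover have "((\<lambda>t. norm (\<sigma> - \<gamma> t)) \<longlongrightarrow> norm (\<sigma> - \<sigma>)) at_top"
    by (intro tendsto_intros orbit_tendsto)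
  ultimately have "1 / (M * H) \<le> norm (\<sigma> - \<sigma>)"
    by (intro tendsto_lowerbound) auto
  moreover have "1 / (M * H) > 0" using M H by simp
  ultimately show False by simp
qed

text \<open>For large times this follows from the limit being different from \<tau>; a compact
  initial piece stays inside the disk.\<close>

lemma orbit_away_from_\<tau>: "\<exists>\<delta>>0. \<forall>t\<ge>0. \<delta> \<le> norm (\<tau> - \<gamma> t)"
proof -
  define e where "e = norm (\<tau> - \<sigma>) / 2"
  have e: "e > 0" using \<sigma>_neq_\<tau> by (simp add: e_def)
  have "((\<lambda>t. norm (\<tau> - \<gamma> t)) \<longlongrightarrow> norm (\<tau> - \<sigma>)) at_top"
    by (intro tendsto_intros orbit_tendsto)
  moreover have "e < norm (\<tau> - \<sigma>)" using e by (simp add: e_def)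
  ultimately have "\<forall>\<^sub>F t in at_top. e < norm (\<tau> - \<gamma> t)" by (rule order_tendstoD)
  then obtain T0 where "\<And>t. t \<ge> T0 \<Longrightarrow> e < norm (\<tau> - \<gamma> t)"
    by (auto simp: eventually_at_top_linorder)
  then obtain T where T: "T \<ge> 0" "\<And>t. t \<ge> T \<Longrightarrow> e < norm (\<tau> - \<gamma> t)"
    by (metis max.bounded_iff max.cobounded1 nle_le)
  have "continuous_on {0..T} (\<lambda>t. norm (\<tau> - \<gamma> t))"
    by (intro continuous_intros continuous_on_subset[OF continuous_orbit]) auto
  then obtain s where s: "s \<in> {0..T}" "\<And>t. t \<in> {0..T} \<Longrightarrow> norm (\<tau> - \<gamma> s) \<le> norm (\<tau> - \<gamma> t)"
    using continuous_attains_inf[of "{0..T}"] T(1) by fastforce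
  have "norm (\<tau> - \<gamma> s) > 0" using orbit_in_disk[of s] s(1) norm_\<tau> by auto
  moreover have "min e (norm (\<tau> - \<gamma> s)) \<le> norm (\<tau> - \<gamma> t)" if "t \<ge> 0" for t
    using s(2)[of t] T(2)[of t] that by (cases "t \<le> T") auto
  ultimately show ?thesis using e by (intro exI[of _ "min e (norm (\<tau> - \<gamma> s))"]) auto
qed

text \<open>Choosing one such bound for the whole locale lets it appear in the later
  constants.\<close>

definition \<delta> where "\<delta> = (SOME d. d > 0 \<and> (\<forall>t\<ge>0. d \<le> norm (\<tau> - \<gamma> t)))"

lemma \<delta>_pos: "\<delta> > 0" and \<delta>_le: "t \<ge> 0 \<Longrightarrow> \<delta> \<le> norm (\<tau> - \<gamma> t)"
  using someI_ex[OF orbit_away_from_\<tau>] unfolding \<delta>_def by auto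

lemma norm_\<tau>_diff_pos: "t \<ge> 0 \<Longrightarrow> 0 < norm (\<tau> - \<gamma> t)"
  using \<delta>_le[of t] \<delta>_pos by linarith

lemma norm_\<tau>_diff_le: "t \<ge> 0 \<Longrightarrow> norm (\<tau> - \<gamma> t) \<le> 2"
  using norm_triangle_ineq4[of \<tau> "\<gamma> t"] orbit_in_disk[of t] norm_\<tau> by simp

text \<open>With \<open>horo_orbit_lower\<close>, this makes \<open>horo \<tau>\<close> comparable
  to the distance to the circle along the orbit: the denominator of \<open>horo\<close> stays
  between \<open>\<delta>\<^sup>2\<close> and \<open>4\<close>.\<close>

lemma horo_orbit_upper:
  assumes "t \<ge> 0" shows "horo \<tau> (\<gamma> t) \<le> 2 * (1 - norm (\<gamma> t)) / \<delta>\<^sup>2"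
  unfolding horo_def
proof (rule frac_le)
  have "(1 + norm (\<gamma> t)) * (1 - norm (\<gamma> t)) \<le> 2 * (1 - norm (\<gamma> t))"
    using orbit_in_disk[OF assms] by (intro mult_right_mono) auto
  then show "1 - (norm (\<gamma> t))\<^sup>2 \<le> 2 * (1 - norm (\<gamma> t))"
    by (simp add: power2_eq_square algebra_simps)
  show "\<delta>\<^sup>2 \<le> (norm (\<tau> - \<gamma> t))\<^sup>2" using \<delta>_le[OF assms] \<delta>_pos by (intro power_mono) auto
qed (use orbit_in_disk[OF assms] \<delta>_pos in auto)

lemma horo_orbit_lower:
  assumes "t \<ge> 0" shows "1 - norm (\<gamma> t) \<le> 4 * horo \<tau> (\<gamma> t)"
proof -
  have "1 - norm (\<gamma> t) \<le> 1 - (norm (\<gamma> t))\<^sup>2"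
    using orbit_in_disk[OF assms] by (auto simp: power2_eq_square mult_left_le)
  also have "\<dots> = horo \<tau> (\<gamma> t) * (norm (\<tau> - \<gamma> t))\<^sup>2"
    using norm_\<tau>_diff_pos[OF assms] by (simp add: horo_def)
  also have "\<dots> \<le> horo \<tau> (\<gamma> t) * 2\<^sup>2"
    using norm_\<tau>_diff_le[OF assms] horo_pos[OF norm_\<tau> orbit_in_disk[OF assms]]
    by (intro mult_left_mono power_mono) auto
  finally show ?thesis by simp
qed

section \<open>The orbit in the half-plane model\<close>

definition W where "W t = cayley \<tau> (\<gamma> t)"

text \<open>The displacement of \<open>\<phi> h\<close> in the half-plane model. On the orbit it
  yields the increments of \<open>W\<close> over steps of length \<open>h\<close>, so these are
  values of one function to which Harnack applies.\<close>

definition F where "F h z = cayley \<tau> (\<phi> h z) - cayley \<tau> z"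

lemma Re_W: "Re (W t) = horo \<tau> (\<gamma> t)"
  by (simp add: W_def Re_cayley norm_\<tau>)

lemma W_diff:
  assumes "s \<ge> 0" "t \<ge> 0"
  shows "norm (W s - W t) = 2 * norm (\<gamma> s - \<gamma> t) / (norm (\<tau> - \<gamma> s) * norm (\<tau> - \<gamma> t))"
proof -
  have "\<gamma> s \<noteq> \<tau>" "\<gamma> t \<noteq> \<tau>" using orbit_in_disk assms norm_\<tau> by force+
  then show ?thesis
    unfolding W_def by (simp add: cayley_diff norm_divide norm_mult norm_\<tau>)
qed

text \<open>With \<open>W_diff_lower\<close>, increments of \<open>W\<close> and of the orbit are
  comparable, since both factors in the denominator of \<open>W_diff\<close> lie between \<delta>
  and \<open>2\<close>.\<close>

lemma W_diff_upper:
  assumes "s \<ge> 0" "t \<ge> 0"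
  shows "norm (W s - W t) \<le> 2 / \<delta>\<^sup>2 * norm (\<gamma> s - \<gamma> t)"
proof -
  have "2 * norm (\<gamma> s - \<gamma> t) / (norm (\<tau> - \<gamma> s) * norm (\<tau> - \<gamma> t)) \<le> 2 * norm (\<gamma> s - \<gamma> t) / (\<delta> * \<delta>)"
    using \<delta>_le norm_\<tau>_diff_pos assms \<delta>_pos
    by (intro divide_left_mono mult_mono mult_pos_pos) auto
  then show ?thesis by (simp add: W_diff assms power2_eq_square)
qed

lemma W_diff_lower:
  assumes "s \<ge> 0" "t \<ge> 0"
  shows "norm (\<gamma> s - \<gamma> t) \<le> 2 * norm (W s - W t)"
proof -
  have "2 * norm (\<gamma> s - \<gamma> t) / (2 * 2) \<le> 2 * norm (\<gamma> s - \<gamma> t) / (norm (\<tau> - \<gamma> s) * norm (\<tau> - \<gamma> t))"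
    using norm_\<tau>_diff_le norm_\<tau>_diff_pos assms
    by (intro divide_left_mono mult_mono mult_pos_pos) auto
  then show ?thesis by (simp add: W_diff assms)
qed

lemma F_holomorphic:
  assumes "h \<ge> 0" shows "F h holomorphic_on unit_disk"
proof -
  have "(cayley \<tau> \<circ> \<phi> h) holomorphic_on unit_disk"
    by (rule holomorphic_on_compose_gen[OF disk_semigroupD(1) cayley_holomorphic])
       (use semigroup assms norm_\<tau> disk_semigroupD(3) in auto)
  then show ?thesis
    unfolding F_def[abs_def] o_def by (intro holomorphic_intros cayley_holomorphic norm_\<tau>)
qed

lemma Re_F_nonneg: "h \<ge> 0 \<Longrightarrow> norm z < 1 \<Longrightarrow> Re (F h z) \<ge> 0"
  by (simp add: F_def Re_cayley norm_\<tau> horo_increasing)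

lemma F_orbit: "h \<ge> 0 \<Longrightarrow> t \<ge> 0 \<Longrightarrow> F h (\<gamma> (t + h)) = W t - W (t + h)"
  by (simp add: F_def W_def orbit_back)

text \<open>Harnack between \<open>0\<close> and \<open>z = \<gamma> (t + 1)\<close> bounds the drop
  of \<open>horo \<tau>\<close> in unit time below by a multiple of \<open>1 - norm z\<close>, hence
  of \<open>horo \<tau> z\<close> itself. So \<open>horo \<tau>\<close> shrinks at least by a fixed
  factor per unit of time.\<close>

lemma orbit_decay: "\<exists>K c. K > 0 \<and> c > 0 \<and> (\<forall>t\<ge>0. 1 - norm (\<gamma> t) \<le> K * exp (- c * t))"
proof -
  define a where "a = Re (F 1 0)"
  define H where "H = horo \<tau> (\<gamma> 0)"
  have H: "H > 0" using horo_pos[OF norm_\<tau> orbit_in_disk[of 0]] by (simp add: H_def)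
  \<comment> \<open>If \<open>a\<close> vanished, so would \<open>Re (F 1 z)\<close> for all
    \<open>z\<close>; then \<open>horo \<tau>\<close> would be constant at integer times, although
    it tends to \<open>0\<close> along the orbit.\<close>
  have a: "a > 0"
  proof (rule ccontr)
    assume "\<not> a > 0"
    then have a0: "a = 0" using Re_F_nonneg[of 1 0] by (simp add: a_def)
    have F0: "Re (F 1 z) = 0" if z: "norm z < 1" for z
    proof -
      have "(1 - pdist 0 z) * Re (F 1 z) \<le> (1 + pdist 0 z) * a"
        unfolding a_def by (rule Harnack_Re) (use z in \<open>auto intro: F_holomorphic Re_F_nonneg\<close>)
      moreover have "pdist 0 z < 1" using pdist_lt_1[of 0 z] z by simp
      ultimately have "Re (F 1 z) \<le> 0" using a0 by (simp add: mult_le_0_iff)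
      then show ?thesis using Re_F_nonneg[of 1 z] z by simp
    qed
    have eqH: "horo \<tau> (\<gamma> (real n)) = H" for n
    proof (induction n)
      case (Suc n)
      have "Re (W (real n)) = Re (W (real n + 1))"
        using F_orbit[of 1 "real n"] F0[of "\<gamma> (real n + 1)"] orbit_in_disk[of "real n + 1"] by simp
      with Suc show ?case by (simp add: Re_W add.commute)
    qed (simp add: H_def)
    have "((\<lambda>t. 2 * (1 - norm (\<gamma> t)) / \<delta>\<^sup>2) \<longlongrightarrow> 2 * (1 - norm \<sigma>) / \<delta>\<^sup>2) at_top"
      using \<delta>_pos by (intro tendsto_intros orbit_tendsto) auto
    then have "\<forall>\<^sub>F t in at_top. 2 * (1 - norm (\<gamma> t)) / \<delta>\<^sup>2 < H"
      by (rule order_tendstoD) (use H norm_\<sigma> in simp)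
    then obtain T where T: "\<And>t. t \<ge> T \<Longrightarrow> 2 * (1 - norm (\<gamma> t)) / \<delta>\<^sup>2 < H"
      by (auto simp: eventually_at_top_linorder)
    obtain n where "T \<le> real n" using real_arch_simple by blast
    then show False
      using T[of "real n"] horo_orbit_upper[of "real n"] eqH[of n] by simp
  qed
  \<comment> \<open>The drop is at least \<open>(1 - norm z) * a / 2\<close>, and
    \<open>1 - norm z \<ge> \<delta>\<^sup>2 / 2 * horo \<tau> z\<close>.\<close>
  define q where "q = 1 + a * \<delta>\<^sup>2 / 4"
  have q: "q > 1" using a \<delta>_pos by (simp add: q_def)
  have step: "q * horo \<tau> (\<gamma> (t + 1)) \<le> horo \<tau> (\<gamma> t)" if t: "t \<ge> 0" for t
  proof -
    define z where "z = \<gamma> (t + 1)"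
    have z: "norm z < 1" using orbit_in_disk t by (simp add: z_def)
    have "(1 - norm z) * a \<le> (1 + norm z) * Re (F 1 z)"
      using Harnack_Re[OF F_holomorphic[of 1] Re_F_nonneg[of 1] z, of 0] by (simp add: a_def)
    also have "\<dots> \<le> 2 * Re (F 1 z)"
      using z Re_F_nonneg[of 1 z] by (intro mult_right_mono) auto
    also have "Re (F 1 z) = horo \<tau> (\<gamma> t) - horo \<tau> z"
      using F_orbit[of 1 t] t by (simp add: z_def Re_W)
    finally have "(1 - norm z) * a \<le> 2 * (horo \<tau> (\<gamma> t) - horo \<tau> z)" .
    moreover define Y where "Y = horo \<tau> z * (a * \<delta>\<^sup>2 / 2)"
    have "Y \<le> 2 * (1 - norm z) / \<delta>\<^sup>2 * (a * \<delta>\<^sup>2 / 2)"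
      unfolding Y_def using horo_orbit_upper[of "t + 1"] t a
      by (intro mult_right_mono) (auto simp: z_def)
    moreover have "2 * (1 - norm z) / \<delta>\<^sup>2 * (a * \<delta>\<^sup>2 / 2) = (1 - norm z) * a"
      using \<delta>_pos by simp
    moreover have "q * horo \<tau> z = horo \<tau> z + Y / 2"
      by (simp add: q_def Y_def algebra_simps)
    ultimately show ?thesis
      unfolding z_def by argo
  qed
  have pow: "q ^ n * horo \<tau> (\<gamma> (real n)) \<le> H" for n
  proof (induction n)
    case (Suc n)
    have "q ^ n * (q * horo \<tau> (\<gamma> (real n + 1))) \<le> q ^ n * horo \<tau> (\<gamma> (real n))"
      using q by (intro mult_left_mono step) auto
    with Suc show ?case by (simp add: ac_simps)
  qed (simp add: H_def)
  have "1 - norm (\<gamma> t) \<le> 4 * H * q * exp (- ln q * t)" if t: "t \<ge> 0" for t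
  proof -
    define n where "n = nat \<lfloor>t\<rfloor>"
    have n: "real n \<le> t" "t \<le> real n + 1" using t by (auto simp: n_def)
    have qn: "q ^ n = exp (ln q * real n)" using q by (simp add: exp_of_nat2_mult)
    have "1 - norm (\<gamma> t) \<le> 4 * horo \<tau> (\<gamma> t)" by (rule horo_orbit_lower[OF t])
    also have "horo \<tau> (\<gamma> t) \<le> horo \<tau> (\<gamma> (real n))" using n by (intro horo_orbit_decreasing) auto
    also have "\<dots> \<le> H * exp (- ln q * real n)"
      using pow[of n] unfolding qn by (simp add: exp_minus field_simps)
    \<comment> \<open>Rounding \<open>t\<close> down to an integer costs one factor
      \<open>q\<close>.\<close>
    also have "\<dots> \<le> H * exp (ln q + (- ln q * t))"
    proof -
      have "ln q * t \<le> ln q * (real n + 1)" using q n by (intro mult_left_mono) auto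
      then show ?thesis using H by (simp add: algebra_simps)
    qed
    also have "\<dots> = H * q * exp (- ln q * t)" unfolding exp_add using q by simp
    finally show ?thesis by simp
  qed
  moreover have "4 * H * q > 0" "ln q > 0" using H q by auto
  ultimately show ?thesis by metis
qed

end

section \<open>Hyperbolic speed of the orbit\<close>

text \<open>In \<open>one_minus_pdist_sq\<close> the denominator is at least
  \<open>(1 - norm z)\<^sup>2\<close>, and one factor \<open>1 - norm z\<close> cancels. The lemma
  serves twice: regularity makes boundary distances comparable, and decay of
  \<open>1 - norm w\<close> forces \<open>pdist z w\<close> towards \<open>1\<close>.\<close>

lemma pdist_le_imp_comparable:
  assumes "norm z < 1" "norm w < 1"
  shows "(1 - pdist z w) * (1 - norm z) \<le> 4 * (1 - norm w)"
proof -
  define N where "N = norm (1 - cnj w * z)"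
  have N: "1 - norm z \<le> N" using one_minus_cnj_ge[OF assms(2)] by (simp add: N_def)
  have pos: "N > 0" using N assms(1) by linarith
  have "1 - pdist z w \<le> 1 - (pdist z w)\<^sup>2"
    using pdist_lt_1[OF assms] by (auto simp: power2_eq_square mult_left_le)
  then have "(1 - pdist z w) * N\<^sup>2 \<le> (1 - (norm z)\<^sup>2) * (1 - (norm w)\<^sup>2)"
    using pos by (simp add: one_minus_pdist_sq[OF assms] N_def[symmetric] pos_le_divide_eq)
  moreover have "(1 - pdist z w) * (1 - norm z)\<^sup>2 \<le> (1 - pdist z w) * N\<^sup>2"
    using N assms pdist_lt_1[OF assms] by (intro mult_left_mono power_mono) auto
  moreover have "(1 - (norm z)\<^sup>2) * (1 - (norm w)\<^sup>2) \<le> (2 * (1 - norm z)) * (2 * (1 - norm w))"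
  proof -
    have "1 - (norm u)\<^sup>2 \<le> 2 * (1 - norm u)" for u :: complex
      using sum_power2_ge_zero[of "norm u - 1" 0] by (simp add: power2_eq_square algebra_simps)
    then show ?thesis using assms
      by (intro mult_mono) (auto simp: abs_square_le_1 less_imp_le)
  qed
  moreover have "(1 - norm z) * ((1 - pdist z w) * (1 - norm z)) = (1 - pdist z w) * (1 - norm z)\<^sup>2"
    by (simp add: power2_eq_square)
  moreover have "(2 * (1 - norm z)) * (2 * (1 - norm w)) = (1 - norm z) * (4 * (1 - norm w))"
    by (simp add: algebra_simps)
  ultimately have "(1 - norm z) * ((1 - pdist z w) * (1 - norm z)) \<le> (1 - norm z) * (4 * (1 - norm w))"
    by linarith
  then show ?thesis using assms by (simp only: mult_le_cancel_left_pos diff_gt_0_iff_gt)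
qed

text \<open>A converse inside a Stolz angle: comparable boundary distances give bounded hyperbolic
  distance. There \<open>N\<close> is at most \<open>L * B\<close>, while the numerator in
  \<open>one_minus_pdist_sq\<close> is at least \<open>B\<^sup>2 / \<kappa>\<close>.\<close>

lemma stolz_imp_pdist_bound:
  assumes z: "norm z < 1" and w: "norm w < 1" and \<kappa>: "\<kappa> > 0" and M: "M > 0"
    and sz: "norm (\<sigma> - z) \<le> M * (1 - norm z)" and sw: "norm (\<sigma> - w) \<le> M * (1 - norm w)"
    and zw: "1 - norm z \<le> \<kappa> * (1 - norm w)" and wz: "1 - norm w \<le> \<kappa> * (1 - norm z)"
  shows "1 / (2 * \<kappa> * (2 + M + M * \<kappa>)\<^sup>2) \<le> 1 - pdist z w"
proof -
  define A where "A = 1 - norm z"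
  define B where "B = 1 - norm w"
  define L where "L = 2 + M + M * \<kappa>"
  define N where "N = norm (1 - cnj w * z)"
  have pos: "A > 0" "B > 0" using z w by (auto simp: A_def B_def)
  have Npos: "N > 0" using one_minus_cnj_pos[OF w z] by (simp add: N_def)
  have "1 - cnj w * z = of_real (1 - (norm w)\<^sup>2) + cnj w * (w - z)"
    by (simp add: algebra_simps complex_norm_square del: of_real_power)
  then have "N \<le> \<bar>1 - (norm w)\<^sup>2\<bar> + norm w * norm (w - z)"
    unfolding N_def by (metis complex_mod_cnj norm_mult norm_of_real norm_triangle_ineq)
  also have "norm w * norm (w - z) \<le> norm (w - z)" using w by (simp add: mult_left_le_one_le)
  also have "norm (w - z) \<le> norm (\<sigma> - z) + norm (\<sigma> - w)"
    using norm_triangle_ineq4[of "\<sigma> - z" "\<sigma> - w"] by simp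
  also have "\<dots> \<le> M * A + M * B" using sz sw by (simp add: A_def B_def)
  also have "M * A \<le> M * (\<kappa> * B)" using zw M by (simp add: A_def B_def)
  also have "\<bar>1 - (norm w)\<^sup>2\<bar> \<le> 2 * B"
    using sum_power2_ge_zero[of "norm w - 1" 0] w
    by (simp add: B_def power2_eq_square algebra_simps abs_le_iff mult_le_one)
  finally have N: "N \<le> L * B" by (simp add: L_def algebra_simps)
  have "B * B \<le> (\<kappa> * A) * B" using wz pos by (intro mult_right_mono) (auto simp: A_def B_def)
  moreover have "A * B \<le> (1 - (norm z)\<^sup>2) * (1 - (norm w)\<^sup>2)"
    using z w by (intro mult_mono) (auto simp: A_def B_def power2_eq_square mult_left_le mult_le_one)
  ultimately have "B * B \<le> \<kappa> * ((1 - (norm z)\<^sup>2) * (1 - (norm w)\<^sup>2))"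
    using \<kappa> by (smt (verit, best) mult.assoc mult_le_cancel_left_pos)
  also have "\<dots> = \<kappa> * ((1 - (pdist z w)\<^sup>2) * N\<^sup>2)"
    using Npos by (simp add: one_minus_pdist_sq[OF z w] N_def)
  also have "\<dots> \<le> \<kappa> * ((2 * (1 - pdist z w)) * (L * B)\<^sup>2)"
  proof -
    have "1 - (pdist z w)\<^sup>2 \<le> 2 * (1 - pdist z w)"
      using sum_power2_ge_zero[of "pdist z w - 1" 0] by (simp add: power2_eq_square algebra_simps)
    then show ?thesis
      using \<kappa> N Npos pdist_lt_1[OF z w] by (intro mult_left_mono mult_mono power_mono) auto
  qed
  finally have "(B * B) * 1 \<le> (B * B) * ((1 - pdist z w) * (2 * \<kappa> * L\<^sup>2))"
    by (simp add: power2_eq_square ac_simps)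
  then have "1 \<le> (1 - pdist z w) * (2 * \<kappa> * L\<^sup>2)"
    using pos by (simp only: mult_le_cancel_left_pos mult_pos_pos)
  moreover have "2 * \<kappa> * L\<^sup>2 > 0" using \<kappa> M by (intro mult_pos_pos zero_less_power) (auto simp: L_def add_pos_pos)
  ultimately show ?thesis unfolding L_def[symmetric] by (simp only: pos_divide_le_eq)
qed

context nontangential_orbit
begin

text \<open>Here the finite limsup enters, converted by \<open>hyp_dist_ge\<close> into a bound
  keeping \<open>pdist\<close> away from \<open>1\<close>.\<close>

lemma orbit_regular: "\<exists>T\<ge>0. \<exists>e>0. \<forall>t\<ge>T. e \<le> 1 - pdist (\<gamma> t) (\<gamma> (t + 1))"
proof -
  have "Limsup at_top (\<lambda>t. ereal (hyp_dist (\<gamma> t) (\<gamma> (t + 1)))) < \<infinity>"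
    using regular by (simp add: regular_backward_orbit_def)
  then obtain C where "Limsup at_top (\<lambda>t. ereal (hyp_dist (\<gamma> t) (\<gamma> (t + 1)))) < ereal C"
    using less_PInf_Ex_of_nat by auto
  then have "\<forall>\<^sub>F t in at_top. ereal (hyp_dist (\<gamma> t) (\<gamma> (t + 1))) < ereal C"
    by (rule Limsup_lessD)
  then obtain T where T: "\<And>t. t \<ge> T \<Longrightarrow> hyp_dist (\<gamma> t) (\<gamma> (t + 1)) < C"
    by (auto simp: eventually_at_top_linorder)
  have "exp (- 2 * C) \<le> 1 - pdist (\<gamma> t) (\<gamma> (t + 1))" if t: "t \<ge> max T 0" for t
  proof -
    have d: "norm (\<gamma> t) < 1" "norm (\<gamma> (t + 1)) < 1" using t by (auto intro: orbit_in_disk)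
    have "- ln (1 - pdist (\<gamma> t) (\<gamma> (t + 1))) / 2 \<le> C"
      using hyp_dist_ge[OF d] T[of t] t by simp
    then have "- 2 * C \<le> ln (1 - pdist (\<gamma> t) (\<gamma> (t + 1)))" by simp
    then show ?thesis
      using pdist_lt_1[OF d] by (simp add: ln_ge_iff)
  qed
  then show ?thesis by (intro exI[of _ "max T 0"] conjI exI[of _ "exp (- 2 * C)"]) auto
qed

text \<open>The monotonicity of \<open>horo \<tau>\<close> carries over to
  \<open>1 - norm (\<gamma> t)\<close> up to the comparability constants \<open>4\<close> and
  \<open>2 / \<delta>\<^sup>2\<close>.\<close>

lemma orbit_one_minus_norm_le:
  assumes "0 \<le> s" "s \<le> t" shows "1 - norm (\<gamma> t) \<le> 8 / \<delta>\<^sup>2 * (1 - norm (\<gamma> s))"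
proof -
  have "1 - norm (\<gamma> t) \<le> 4 * (2 * (1 - norm (\<gamma> s)) / \<delta>\<^sup>2)"
    using horo_orbit_lower[of t] horo_orbit_decreasing[OF assms] horo_orbit_upper[OF assms(1)] assms
    by linarith
  then show ?thesis by simp
qed

text \<open>Consecutive increments of \<open>W\<close> over steps of length \<open>1/n\<close> are values of one function with
  nonnegative real part at points of bounded hyperbolic distance, so by Harnack's inequality each
  of them is at most a constant times their mean.\<close>
lemma orbit_speed_eventually:
  "\<exists>T\<ge>0. \<exists>K. \<forall>t\<ge>T. \<forall>n>0. pdist (\<gamma> t) (\<gamma> (t + 1 / real n)) \<le> K / real n"
proof -
  obtain M T1 where M: "M > 1" and T1: "T1 \<ge> 0"
    and st: "\<And>t. t \<ge> T1 \<Longrightarrow> norm (\<sigma> - \<gamma> t) < M * (1 - norm (\<gamma> t))"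
    using stolz by metis
  obtain T2 e where T2: "T2 \<ge> 0" and e: "e > 0"
    and reg: "\<And>t. t \<ge> T2 \<Longrightarrow> e \<le> 1 - pdist (\<gamma> t) (\<gamma> (t + 1))"
    using orbit_regular by metis
  define c where "c = 8 / \<delta>\<^sup>2"
  define \<kappa> where "\<kappa> = c * (4 / e * c)"
  define \<epsilon> where "\<epsilon> = 1 / (2 * \<kappa> * (2 + M + M * \<kappa>)\<^sup>2)"
  \<comment> \<open>\<open>K\<close> combines the constant of \<open>norm_le_norm_sum\<close> for
    \<open>2 / \<epsilon>\<close> and \<open>\<epsilon> / 2\<close>, the bound for
    \<open>W t - W (t + 1)\<close>, and the factor \<open>2\<close> of
    \<open>W_diff_lower\<close>.\<close>
  define K where "K = 2 * ((1 + (2 / \<epsilon>) / (\<epsilon> / 2)) * (2 / \<delta>\<^sup>2 * (M * (1 + c))))"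
  have c: "c > 0" using \<delta>_pos by (simp add: c_def)
  have \<kappa>: "\<kappa> > 0" using c e by (simp add: \<kappa>_def)
  have \<epsilon>: "\<epsilon> > 0" using \<kappa> M by (auto simp: \<epsilon>_def intro!: mult_pos_pos add_pos_pos zero_less_power)
  define T where "T = max T1 T2"
  have T: "T \<ge> 0" "T \<ge> T1" "T \<ge> T2" using T1 by (auto simp: T_def)
  \<comment> \<open>Compare time \<open>t + s\<close> with \<open>t\<close>, then \<open>t\<close>
    with \<open>t + 1\<close> by regularity, then \<open>t + 1\<close> with
    \<open>t + r\<close>.\<close>
  have cmp: "1 - norm (\<gamma> (t + s)) \<le> \<kappa> * (1 - norm (\<gamma> (t + r)))"
    if "t \<ge> T" "s \<in> {0..1}" "r \<in> {0..1}" for t s r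
  proof -
    have d: "norm (\<gamma> t) < 1" "norm (\<gamma> (t + 1)) < 1" using that T by (auto intro: orbit_in_disk)
    have "e * (1 - norm (\<gamma> t)) \<le> (1 - pdist (\<gamma> t) (\<gamma> (t + 1))) * (1 - norm (\<gamma> t))"
      using reg[of t] that T d by (intro mult_right_mono) auto
    also have "\<dots> \<le> 4 * (1 - norm (\<gamma> (t + 1)))" by (rule pdist_le_imp_comparable[OF d])
    also have "\<dots> \<le> 4 * (c * (1 - norm (\<gamma> (t + r))))"
      unfolding c_def using that T by (intro mult_left_mono orbit_one_minus_norm_le) auto
    finally have "1 - norm (\<gamma> t) \<le> 4 / e * c * (1 - norm (\<gamma> (t + r)))"
      using e by (simp add: field_simps)
    then have "c * (1 - norm (\<gamma> t)) \<le> c * (4 / e * c * (1 - norm (\<gamma> (t + r))))"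
      using c by (intro mult_left_mono) auto
    moreover have "1 - norm (\<gamma> (t + s)) \<le> c * (1 - norm (\<gamma> t))"
      using orbit_one_minus_norm_le[of t "t + s"] that T by (simp add: c_def)
    ultimately show ?thesis by (simp add: \<kappa>_def mult.assoc)
  qed
  have bd: "\<epsilon> \<le> 1 - pdist (\<gamma> (t + s)) (\<gamma> (t + r))"
    if "t \<ge> T" "s \<in> {0..1}" "r \<in> {0..1}" for t s r
    unfolding \<epsilon>_def
    by (rule stolz_imp_pdist_bound[where \<sigma> = \<sigma>])
       (use that T \<kappa> M cmp st[of "t + s"] st[of "t + r"] in \<open>auto intro: orbit_in_disk\<close>)
  have "pdist (\<gamma> t) (\<gamma> (t + 1 / real n)) \<le> K / real n" if t: "t \<ge> T" and n: "n > 0" for t n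
  proof -
    define h where "h = 1 / real n"
    have h: "0 < h" "h \<le> 1" "real n * h = 1" using n by (auto simp: h_def)
    have t0: "t \<ge> 0" using t T by simp
    \<comment> \<open>The argument carries \<open>Suc k\<close> because \<open>F h\<close> at time
      \<open>s + h\<close> gives the increment from \<open>s\<close> to \<open>s + h\<close>. Thus
      \<open>u 0 = g\<close>, and the sum telescopes to the increment over
      \<open>[t, t + 1]\<close>.\<close>
    define u where "u = (\<lambda>k. F h (\<gamma> (t + real (Suc k) * h)))"
    define g where "g = F h (\<gamma> (t + h))"
    define x where "x = 1 - norm (\<gamma> t)"
    have x: "x > 0" using orbit_in_disk[OF t0] by (simp add: x_def)
    have u_eq: "u k = W (t + real k * h) - W (t + real (Suc k) * h)" for k
      using F_orbit[of h "t + real k * h"] h t0 by (simp add: u_def algebra_simps)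
    have g_eq: "g = W t - W (t + h)" using F_orbit[of h t] h t0 by (simp add: g_def)
    have "(\<Sum>k<n. u k) = W (t + real 0 * h) - W (t + real n * h)"
      unfolding u_eq by (rule sum_lessThan_telescope')
    then have sum: "(\<Sum>k<n. u k) = W t - W (t + 1)" by (simp add: h)
    have p: "\<epsilon> \<le> 1 - pdist (\<gamma> (t + real (Suc k) * h)) (\<gamma> (t + h))" if "k < n" for k
    proof (rule bd[OF t])
      have "real (Suc k) * h \<le> real n * h" using that h by (intro mult_right_mono) auto
      then show "real (Suc k) * h \<in> {0..1}" using h by auto
    qed (use h in auto)
    have ga: "Re g \<ge> 0" unfolding g_def by (rule Re_F_nonneg) (use h t0 orbit_in_disk in auto)
    have dsk: "norm (\<gamma> (t + real (Suc k) * h)) < 1" "norm (\<gamma> (t + h)) < 1" for k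
      using h t0 by (auto intro!: orbit_in_disk)
    have "real n * norm g \<le> (1 + (2 / \<epsilon>) / (\<epsilon> / 2)) * norm (\<Sum>k<n. u k)"
    proof (rule norm_le_norm_sum)
      fix k assume k: "k < n"
      define r where "r = pdist (\<gamma> (t + real (Suc k) * h)) (\<gamma> (t + h))"
      have r: "0 \<le> r" "\<epsilon> \<le> 1 - r" using p[OF k] by (auto simp: r_def)
      have "\<epsilon> * norm (u k - g) \<le> (1 - r) * norm (u k - g)"
        using r by (intro mult_right_mono) auto
      also have "\<dots> \<le> 2 * r * Re g"
        unfolding r_def u_def g_def
        by (rule Harnack_norm) (use h dsk in \<open>auto intro: F_holomorphic Re_F_nonneg\<close>)
      also have "\<dots> \<le> 2 * Re g" using r \<epsilon> ga by (simp add: mult_left_le_one_le)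
      finally show "norm (u k - g) \<le> 2 / \<epsilon> * Re g" using \<epsilon> by (simp add: field_simps)
      have "\<epsilon> * Re g \<le> (1 - r) * Re g" using r ga by (intro mult_right_mono) auto
      also have "\<dots> \<le> (1 + r) * Re (u k)"
        unfolding r_def u_def g_def
        by (rule Harnack_Re) (use h dsk in \<open>auto intro: F_holomorphic Re_F_nonneg\<close>)
      also have "\<dots> \<le> 2 * Re (u k)"
      proof (intro mult_right_mono)
        show "0 \<le> Re (u k)" unfolding u_def by (rule Re_F_nonneg) (use h dsk in auto)
      qed (use r \<epsilon> in auto)
      finally show "\<epsilon> / 2 * Re g \<le> Re (u k)" by simp
    qed (use \<epsilon> in auto)
    moreover have "norm (\<Sum>k<n. u k) \<le> 2 / \<delta>\<^sup>2 * (M * (1 + c) * x)"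
    proof -
      have "norm (\<gamma> t - \<gamma> (t + 1)) \<le> norm (\<sigma> - \<gamma> t) + norm (\<sigma> - \<gamma> (t + 1))"
        using norm_triangle_ineq4[of "\<sigma> - \<gamma> (t + 1)" "\<sigma> - \<gamma> t"] by simp
      also have "\<dots> \<le> M * x + M * (1 - norm (\<gamma> (t + 1)))"
        using st[of t] st[of "t + 1"] t T by (simp add: x_def)
      also have "\<dots> \<le> M * x + M * (c * x)"
        unfolding c_def x_def
        using t0 M by (intro add_left_mono mult_left_mono orbit_one_minus_norm_le) auto
      finally have "2 / \<delta>\<^sup>2 * norm (\<gamma> t - \<gamma> (t + 1)) \<le> 2 / \<delta>\<^sup>2 * (M * (1 + c) * x)"
        by (intro mult_left_mono) (auto simp: algebra_simps)
      then show ?thesis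
        unfolding sum using W_diff_upper[of t "t + 1"] t0 by linarith
    qed
    then have "(1 + (2 / \<epsilon>) / (\<epsilon> / 2)) * norm (\<Sum>k<n. u k)
        \<le> (1 + (2 / \<epsilon>) / (\<epsilon> / 2)) * (2 / \<delta>\<^sup>2 * (M * (1 + c) * x))"
      using \<epsilon> by (intro mult_left_mono) auto
    moreover have "K * x = 2 * ((1 + (2 / \<epsilon>) / (\<epsilon> / 2)) * (2 / \<delta>\<^sup>2 * (M * (1 + c) * x)))"
      by (simp only: K_def mult_ac)
    ultimately have "real n * (2 * norm g) \<le> K * x" by argo
    then have "2 * norm g \<le> K * x / real n"
      using n by (simp add: pos_le_divide_eq mult.commute)
    then have "norm (\<gamma> t - \<gamma> (t + h)) \<le> K * x / real n"
      using W_diff_lower[of t "t + h"] t0 h by (simp add: g_eq)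
    then have "norm (\<gamma> t - \<gamma> (t + h)) / x \<le> K / real n"
      using x by (simp add: divide_le_eq)
    then show ?thesis
      using pdist_le_divide[OF orbit_in_disk[OF t0] dsk(2)] by (simp add: x_def h_def)
  qed
  with T(1) show ?thesis by blast
qed

text \<open>Shifting by \<open>T\<close> only increases \<open>pdist\<close> along the orbit, so the
  bound for large times holds from time \<open>0\<close> on.\<close>

lemma orbit_speed:
  "\<exists>K>0. \<forall>t\<ge>0. \<forall>n>0. pdist (\<gamma> t) (\<gamma> (t + 1 / real n)) \<le> K / real n"
proof -
  obtain T K where T: "T \<ge> 0"
    and K: "\<And>t n. t \<ge> T \<Longrightarrow> n > 0 \<Longrightarrow> pdist (\<gamma> t) (\<gamma> (t + 1 / real n)) \<le> K / real n"
    using orbit_speed_eventually by metis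
  have "pdist (\<gamma> t) (\<gamma> (t + 1 / real n)) \<le> max K 1 / real n" if t: "t \<ge> 0" and n: "n > 0" for t n
  proof -
    have "pdist (\<gamma> t) (\<gamma> (t + 1 / real n)) \<le> pdist (\<gamma> (t + T)) (\<gamma> (t + 1 / real n + T))"
      using t T by (intro pdist_orbit_increasing) auto
    also have "\<dots> = pdist (\<gamma> (t + T)) (\<gamma> (t + T + 1 / real n))" by (simp add: ac_simps)
    also have "\<dots> \<le> K / real n" using K[of "t + T" n] t T n by simp
    also have "\<dots> \<le> max K 1 / real n" by (intro divide_right_mono) auto
    finally show ?thesis .
  qed
  then show ?thesis by (intro exI[of _ "max K 1"]) auto
qed

end

section \<open>Functions with bounded second differences\<close>

text \<open>Adding \<open>m\<close> steps of length \<open>1 / n\<close> handles rational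
  increments; continuity gives the rest.\<close>

lemma lipschitz_on_if_unit_fraction_bound:
  fixes f :: "real \<Rightarrow> 'a::real_normed_vector"
  assumes cont: "continuous_on {0..} f" and L: "L \<ge> 0"
    and step: "\<And>t n. t \<ge> 0 \<Longrightarrow> n > 0 \<Longrightarrow> norm (f t - f (t + 1 / real n)) \<le> L / real n"
  shows "L-lipschitz_on {0..} f"
proof (rule lipschitz_on_leI)
  fix u v :: real assume uv: "u \<in> {0..}" "v \<in> {0..}" "u \<le> v"
  have steps: "norm (f u - f (u + real m / real n)) \<le> L * (real m / real n)" if n: "n > 0" for m n
  proof (induction m)
    case (Suc m)
    have eq: "u + real (Suc m) / real n = u + real m / real n + 1 / real n"
      by (simp add: add_divide_distrib)
    have "norm (f (u + real m / real n) - f (u + real (Suc m) / real n)) \<le> L / real n"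
      unfolding eq by (rule step) (use uv n in auto)
    with Suc have "norm (f u - f (u + real (Suc m) / real n)) \<le> L * (real m / real n) + L / real n"
      by (rule norm_diff_triangle_le)
    also have "\<dots> = L * (real (Suc m) / real n)" by (simp add: add_divide_distrib distrib_left)
    finally show ?case .
  qed simp
  have "\<exists>m. real m \<le> (v - u) * real (Suc k) \<and> (v - u) * real (Suc k) \<le> real m + 1" for k
    using uv by (intro exI[of _ "nat \<lfloor>(v - u) * real (Suc k)\<rfloor>"]) (simp del: of_nat_Suc)
  then obtain m where m: "\<And>k. real (m k) \<le> (v - u) * real (Suc k)"
      "\<And>k. (v - u) * real (Suc k) \<le> real (m k) + 1" by metis
  define s where "s = (\<lambda>k. real (m k) / real (Suc k))"
  have s: "s k \<le> v - u" "v - u + - inverse (real (Suc k)) \<le> s k" for k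
  proof -
    show "s k \<le> v - u" unfolding s_def using m(1)[of k] by (simp add: pos_divide_le_eq del: of_nat_Suc)
    have "v - u \<le> (real (m k) + 1) / real (Suc k)" using m(2)[of k] by (simp add: pos_le_divide_eq del: of_nat_Suc)
    then show "v - u + - inverse (real (Suc k)) \<le> s k"
      unfolding s_def by (simp add: add_divide_distrib inverse_eq_divide del: of_nat_Suc)
  qed
  have "s \<longlonglongrightarrow> v - u"
    by (rule tendsto_sandwich[OF _ _ LIMSEQ_inverse_real_of_nat_add_minus tendsto_const]) (use s in auto)
  then have lim: "(\<lambda>k. u + s k) \<longlonglongrightarrow> v" using tendsto_add[OF tendsto_const[of u], of s "v - u" sequentially] by simp
  have "(\<lambda>k. f (u + s k)) \<longlonglongrightarrow> f v"
    by (rule continuous_on_tendsto_compose[OF cont lim]) (use uv in \<open>auto simp: s_def\<close>)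
  then have "(\<lambda>k. norm (f u - f (u + s k))) \<longlonglongrightarrow> norm (f u - f v)"
    by (rule tendsto_norm[OF tendsto_diff[OF tendsto_const]])
  moreover have "norm (f u - f (u + s k)) \<le> L * (v - u)" for k
    using steps[of "Suc k" "m k"] mult_left_mono[OF s(1)[of k] L]
    unfolding s_def by simp
  ultimately have "norm (f u - f v) \<le> L * (v - u)" by (blast intro: LIMSEQ_le_const2)
  then show "dist (f u) (f v) \<le> L * dist u v" using uv by (simp add: dist_norm)
qed (use L in auto)

text \<open>The mean \<open>U s = \<integral>\<^bsub>s-\<epsilon>\<^esub>\<^bsup>s\<^esup> f\<close> is differentiable, and the bound on second differences shows that
  the difference quotients of \<open>f\<close> and \<open>U / \<epsilon>\<close> differ by at most \<open>K \<epsilon>\<close>.\<close>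
lemma has_vector_derivative_if_second_difference_bound:
  fixes f :: "real \<Rightarrow> 'a::banach"
  assumes ab: "a < t" "t < b" and cont: "continuous_on {a..b} f" and K: "K \<ge> 0"
    and second: "\<And>u v h. \<lbrakk>u \<in> {a..b}; v \<in> {a..b}; u + h \<in> {a..b}; v + h \<in> {a..b}; h > 0\<rbrakk>
       \<Longrightarrow> norm ((f u - f (u + h)) - (f v - f (v + h))) \<le> K * h * \<bar>u - v\<bar>"
  shows "\<exists>D. (f has_vector_derivative D) (at t)"
proof -
  \<comment> \<open>A negative step reduces to a positive one by exchanging the endpoints.\<close>
  have second': "norm ((f u - f (u + h)) - (f v - f (v + h))) \<le> K * \<bar>h\<bar> * \<bar>u - v\<bar>"
    if "u \<in> {a..b}" "v \<in> {a..b}" "u + h \<in> {a..b}" "v + h \<in> {a..b}" for u v h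
  proof (cases h "0::real" rule: linorder_cases)
    case less
    have "(f u - f (u + h)) - (f v - f (v + h)) = - ((f (u + h) - f u) - (f (v + h) - f v))" by simp
    then have "norm ((f u - f (u + h)) - (f v - f (v + h))) = norm ((f (u + h) - f u) - (f (v + h) - f v))"
      by (metis norm_minus_cancel)
    then show ?thesis
      using second[of "u + h" "v + h" "- h"] that less by simp
  next
    case equal then show ?thesis by simp
  next
    case greater then show ?thesis using second[OF that greater] by simp
  qed
  define q where "q = (\<lambda>h. (1 / h) *\<^sub>R (f (t + h) - f t))"
  define V where "V = (\<lambda>u. integral {a..u} f)"
  have V: "(V has_vector_derivative f s) (at s)" if "s \<in> {a<..<b}" for s
  proof -
    have "(V has_vector_derivative f s) (at s within {a..b})"
      unfolding V_def using that by (intro integral_has_vector_derivative cont) auto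
    then have "(V has_vector_derivative f s) (at s within {a<..<b})"
      by (rule has_vector_derivative_within_subset) auto
    then show ?thesis using that at_within_open[of s "{a<..<b}"] by simp
  qed
  have Vc: "((\<lambda>x. V (c - x)) has_vector_derivative - f (c - x)) (at x)" if "c - x \<in> {a<..<b}" for c x
  proof -
    have "((\<lambda>x. c - x) has_vector_derivative - 1) (at x)"
      by (auto intro!: derivative_eq_intros)
    from vector_diff_chain_at[OF this V[OF that]] show ?thesis by (simp add: o_def)
  qed
  \<comment> \<open>No candidate for the derivative is at hand: for each \<open>e\<close> the
    quotients come close to some \<open>l\<close> depending on \<open>e\<close>, and completeness
    supplies the limit.\<close>
  have "cauchy_filter (filtermap q (at 0))"
    unfolding cauchy_filter_metric_filtermap
  proof (intro allI impI)
    fix e :: real assume e: "e > 0"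
    define \<epsilon> where "\<epsilon> = min ((t - a) / 3) (e / (4 * (K + 1)))"
    have \<epsilon>: "\<epsilon> > 0" "\<epsilon> \<le> (t - a) / 3"
      using ab e K unfolding \<epsilon>_def by (simp_all only: min_less_iff_conj min.cobounded1) simp
    have "\<epsilon> \<le> e / (4 * (K + 1))" by (simp add: \<epsilon>_def)
    then have "\<epsilon> * (4 * (K + 1)) \<le> e" using K by (simp add: pos_le_divide_eq)
    then have K\<epsilon>: "K * \<epsilon> \<le> e / 4" using \<epsilon>(1) by (simp add: algebra_simps)
    define U where "U = (\<lambda>s. V s - V (s - \<epsilon>))"
    define l where "l = (1 / \<epsilon>) *\<^sub>R (f t - f (t - \<epsilon>))"
    have "(U has_vector_derivative f t - f (t - \<epsilon>)) (at t)"
    proof -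
      have "((\<lambda>s. V (s - \<epsilon>)) has_vector_derivative f (t - \<epsilon>)) (at t)"
      proof -
        have "((\<lambda>s. s - \<epsilon>) has_vector_derivative 1) (at t)"
          by (auto intro!: derivative_eq_intros)
        moreover have "(V has_vector_derivative f (t - \<epsilon>)) (at (t - \<epsilon>))"
          using ab \<epsilon> by (intro V) auto
        ultimately show ?thesis using vector_diff_chain_at by (fastforce simp: o_def)
      qed
      then show ?thesis
        unfolding U_def using ab by (intro has_vector_derivative_diff V) auto
    qed
    then have "((\<lambda>h. norm (U (t + h) - U t - h *\<^sub>R (f t - f (t - \<epsilon>))) / norm h) \<longlongrightarrow> 0) (at 0)"
      unfolding has_vector_derivative_def has_derivative_at by simp
    then have ev1: "\<forall>\<^sub>F h in at 0. norm (U (t + h) - U t - h *\<^sub>R (f t - f (t - \<epsilon>))) / norm h < \<epsilon> * (e / 5)"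
      by (rule order_tendstoD) (use \<epsilon> e in simp)
    have ev2: "\<forall>\<^sub>F h in at (0::real). \<bar>h\<bar> < min \<epsilon> (b - t)"
      unfolding eventually_at using \<epsilon> ab by (intro exI[of _ "min \<epsilon> (b - t)"]) auto
    have ev3: "\<forall>\<^sub>F h in at (0::real). h \<noteq> 0" by (simp add: eventually_at_filter)
    have "\<forall>\<^sub>F h in at 0. dist (q h) l < e / 2"
      using ev1 ev2 ev3
    proof eventually_elim
      case (elim h)
      have R: "norm ((U (t + h) - U t) - h *\<^sub>R (f t - f (t - \<epsilon>))) \<le> \<bar>h\<bar> * (\<epsilon> * (e / 5))"
        using elim(1,3) by (simp add: divide_less_eq mult.commute)
      \<comment> \<open>\<open>\<Phi> \<epsilon> - \<Phi> 0\<close> is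
        \<open>- (U (t + h) - U t)\<close>, and the derivative of \<Phi> varies by a second
        difference of \<open>f\<close>. Linearizing at \<open>0\<close> compares
        \<open>U (t + h) - U t\<close> with \<open>\<epsilon>\<close> times the increment of
        \<open>f\<close>.\<close>
      define \<Phi> where "\<Phi> = (\<lambda>x. V (t + h - x) - V (t - x))"
      have "norm (\<Phi> \<epsilon> - \<Phi> 0 - (\<epsilon> - 0) *\<^sub>R (- (f (t + h - 0) - f (t - 0)))) \<le> norm (\<epsilon> - 0) * (K * \<bar>h\<bar> * \<epsilon>)"
      proof (rule vector_differentiable_bound_linearization[where S = "{0..\<epsilon>}" and f' = "\<lambda>x. - (f (t + h - x) - f (t - x))"])
        fix x assume x: "x \<in> {0..\<epsilon>}"
        have in_ab: "t + h - x \<in> {a<..<b}" "t - x \<in> {a<..<b}" "t + h \<in> {a<..<b}" "t \<in> {a<..<b}"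
          using x elim(2) \<epsilon> ab by auto
        have "(\<Phi> has_vector_derivative - f (t + h - x) - (- f (t - x))) (at x)"
          unfolding \<Phi>_def by (intro has_vector_derivative_diff Vc in_ab)
        then show "(\<Phi> has_vector_derivative - (f (t + h - x) - f (t - x))) (at x within {0..\<epsilon>})"
          by (simp add: has_vector_derivative_at_within)
        have "norm ((f (t - x) - f (t - x + h)) - (f t - f (t + h))) \<le> K * \<bar>h\<bar> * \<bar>t - x - t\<bar>"
          by (rule second') (use in_ab in auto)
        also have "\<dots> \<le> K * \<bar>h\<bar> * \<epsilon>" using x K by (intro mult_left_mono) auto
        finally show "norm (- (f (t + h - x) - f (t - x)) - - (f (t + h - 0) - f (t - 0))) \<le> K * \<bar>h\<bar> * \<epsilon>"
          by (simp add: algebra_simps)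
      qed (use \<epsilon> in \<open>auto simp: closed_segment_eq_real_ivl\<close>)
      then have "norm (\<epsilon> *\<^sub>R (f (t + h) - f t) - (U (t + h) - U t)) \<le> \<epsilon> * (K * \<bar>h\<bar> * \<epsilon>)"
        using \<epsilon> by (simp add: \<Phi>_def U_def algebra_simps)
      also have "\<dots> = \<bar>h\<bar> * \<epsilon> * (K * \<epsilon>)" by simp
      also have "\<dots> \<le> \<bar>h\<bar> * \<epsilon> * (e / 4)" using K\<epsilon> \<epsilon> by (intro mult_left_mono) auto
      finally have "norm (\<epsilon> *\<^sub>R (f (t + h) - f t) - h *\<^sub>R (f t - f (t - \<epsilon>))) \<le> \<bar>h\<bar> * \<epsilon> * (e / 4) + \<bar>h\<bar> * (\<epsilon> * (e / 5))"
        using R norm_diff_triangle_le by blast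
      also have "\<dots> < \<bar>h\<bar> * \<epsilon> * (e / 2)"
      proof -
        have "\<bar>h\<bar> * \<epsilon> * (e / 4 + e / 5) < \<bar>h\<bar> * \<epsilon> * (e / 2)"
          using elim(3) \<epsilon> e by (intro mult_strict_left_mono) auto
        then show ?thesis by (simp add: algebra_simps)
      qed
      also have "\<epsilon> *\<^sub>R (f (t + h) - f t) - h *\<^sub>R (f t - f (t - \<epsilon>)) = (h * \<epsilon>) *\<^sub>R (q h - l)"
        using elim(3) \<epsilon> by (simp add: q_def l_def scaleR_diff_right)
      finally have "(\<bar>h\<bar> * \<epsilon>) * norm (q h - l) < (\<bar>h\<bar> * \<epsilon>) * (e / 2)"
        using \<epsilon> by (simp add: abs_mult)
      then show "dist (q h) l < e / 2"
        using elim(3) \<epsilon> by (simp add: dist_norm mult_less_cancel_left_pos)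
    qed
    then show "\<exists>P. eventually P (at 0) \<and> (\<forall>x y. P x \<and> P y \<longrightarrow> dist (q x) (q y) < e)"
      by (intro exI[of _ "\<lambda>h. dist (q h) l < e / 2"]) (metis dist_triangle_half_l dist_commute)
  qed
  then obtain D where "filtermap q (at 0) \<le> nhds D"
    using cauchy_filter_complete_converges[OF _ complete_UNIV, of "filtermap q (at 0)"]
    by (auto simp: filtermap_bot_iff)
  then have "(q \<longlongrightarrow> D) (at 0)" by (simp add: filterlim_def)
  then have "((\<lambda>h. norm (q h - D)) \<longlongrightarrow> 0) (at 0)"
    using LIM_zero tendsto_norm_zero by blast
  moreover have "norm (f (t + h) - f t - h *\<^sub>R D) / norm h = norm (q h - D)" if "h \<noteq> 0" for h
  proof -
    have "f (t + h) - f t - h *\<^sub>R D = h *\<^sub>R (q h - D)"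
      using that by (simp add: q_def scaleR_diff_right)
    then show ?thesis using that by simp
  qed
  ultimately have "((\<lambda>h. norm (f (t + h) - f t - h *\<^sub>R D) / norm h) \<longlongrightarrow> 0) (at 0)"
    by (subst tendsto_cong[where g = "\<lambda>h. norm (q h - D)"]) (auto simp: eventually_at_filter)
  then have "(f has_vector_derivative D) (at t)"
    by (simp add: has_vector_derivative_def has_derivative_at bounded_linear_scaleR_left)
  then show ?thesis by blast
qed

section \<open>Differentiability and hyperbolic length of the orbit\<close>

context nontangential_orbit
begin

lemma orbit_lipschitz: "\<exists>L>0. L-lipschitz_on {0..} \<gamma>"
proof -
  obtain K where K: "K > 0"
    and sp: "\<And>t n. t \<ge> 0 \<Longrightarrow> n > 0 \<Longrightarrow> pdist (\<gamma> t) (\<gamma> (t + 1 / real n)) \<le> K / real n"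
    using orbit_speed by metis
  have "(2 * K)-lipschitz_on {0..} \<gamma>"
  proof (rule lipschitz_on_if_unit_fraction_bound[OF continuous_orbit])
    fix t :: real and n :: nat assume "t \<ge> 0" "n > 0"
    then show "norm (\<gamma> t - \<gamma> (t + 1 / real n)) \<le> 2 * K / real n"
      using norm_diff_le_pdist[of "\<gamma> t" "\<gamma> (t + 1 / real n)"] sp[of t n] by (simp add: orbit_in_disk)
  qed (use K in auto)
  with K show ?thesis by (intro exI[of _ "2 * K"]) auto
qed

text \<open>Harnack for \<open>F h\<close> at the points \<open>\<gamma> (u + h)\<close> and
  \<open>\<gamma> (v + h)\<close> bounds the second difference of \<open>W\<close> by their
  \<open>pdist\<close>, of order \<open>\<bar>u - v\<bar>\<close>, times an increment of
  \<open>W\<close>, of order \<open>h\<close>.\<close>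

lemma W_has_vector_derivative:
  assumes t: "t > 0" shows "\<exists>D. (W has_vector_derivative D) (at t)"
proof -
  obtain L where L: "L > 0" and lip: "L-lipschitz_on {0..} \<gamma>" using orbit_lipschitz by blast
  have lipD: "norm (\<gamma> u - \<gamma> v) \<le> L * \<bar>u - v\<bar>" if "u \<ge> 0" "v \<ge> 0" for u v
    using lipschitz_onD[OF lip] that by (simp add: dist_norm)
  have W_lip: "norm (W u - W v) \<le> 2 / \<delta>\<^sup>2 * (L * \<bar>u - v\<bar>)" if "u \<ge> 0" "v \<ge> 0" for u v
    using order_trans[OF W_diff_upper[OF that] mult_left_mono[OF lipD[OF that]]] by simp
  define m where "m = (1 - norm (\<gamma> t)) / 2"
  have m: "m > 0" using orbit_in_disk[of t] t by (simp add: m_def)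
  \<comment> \<open>So small that on the window the orbit stays at distance \<open>m\<close> from
    the circle and the relevant \<open>pdist\<close> is at most \<open>1 / 2\<close>.\<close>
  define r where "r = min t (m / (4 * L))"
  have "r \<le> m / (4 * L)" by (simp add: r_def)
  then have "4 * (L * r) \<le> m" using L by (simp add: pos_le_divide_eq mult_ac)
  moreover have "r > 0" "r \<le> t" using t m L by (simp_all add: r_def)
  ultimately have r: "r > 0" "r \<le> t" "4 * (L * r) \<le> m" by simp_all
  have far: "1 - norm (\<gamma> s) \<ge> m" if s: "s \<in> {t - r..t + r}" for s
  proof -
    have "norm (\<gamma> s) \<le> norm (\<gamma> t) + norm (\<gamma> s - \<gamma> t)" by (rule norm_triangle_sub)
    also have "norm (\<gamma> s - \<gamma> t) \<le> L * \<bar>s - t\<bar>" using s r by (intro lipD) auto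
    also have "\<dots> \<le> L * r" using s L by (intro mult_left_mono) auto
    finally show ?thesis using r(3) m L r(1) by (simp add: m_def field_simps)
  qed
  define K where "K = 4 * (L / m) * (2 / \<delta>\<^sup>2 * L)"
  show ?thesis
  proof (rule has_vector_derivative_if_second_difference_bound[of "t - r" t "t + r" W K])
    have "(2 / \<delta>\<^sup>2 * L)-lipschitz_on {t - r..t + r} W"
    proof (rule lipschitz_onI)
      fix x y assume "x \<in> {t - r..t + r}" "y \<in> {t - r..t + r}"
      then show "dist (W x) (W y) \<le> 2 / \<delta>\<^sup>2 * L * dist x y"
        using W_lip[of x y] r by (simp add: dist_norm mult.assoc)
    qed (use L in auto)
    then show "continuous_on {t - r..t + r} W" by (rule lipschitz_on_continuous_on)
    show "K \<ge> 0" using L m by (simp add: K_def)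
    fix u v h assume uv: "u \<in> {t - r..t + r}" "v \<in> {t - r..t + r}"
      "u + h \<in> {t - r..t + r}" "v + h \<in> {t - r..t + r}" and h: "h > 0"
    have nn: "u \<ge> 0" "v \<ge> 0" using uv r by auto
    define p where "p = pdist (\<gamma> (u + h)) (\<gamma> (v + h))"
    define \<Delta> where "\<Delta> = (W u - W (u + h)) - (W v - W (v + h))"
    have d: "norm (\<gamma> (u + h)) < 1" "norm (\<gamma> (v + h)) < 1" using nn h by (auto intro: orbit_in_disk)
    have "p \<le> norm (\<gamma> (u + h) - \<gamma> (v + h)) / (1 - norm (\<gamma> (u + h)))"
      unfolding p_def by (rule pdist_le_divide[OF d])
    also have "\<dots> \<le> L * \<bar>u - v\<bar> / m"
      using lipD[of "u + h" "v + h"] nn h far[OF uv(3)] m L by (intro frac_le) auto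
    finally have p1: "p \<le> L / m * \<bar>u - v\<bar>" by simp
    have "L * \<bar>u - v\<bar> \<le> L * (2 * r)" using uv L by (intro mult_left_mono) auto
    then have "2 * (L * \<bar>u - v\<bar>) \<le> m" using r(3) by linarith
    then have "L / m * \<bar>u - v\<bar> \<le> 1 / 2" using m by (simp add: field_simps)
    then have p2: "p \<le> 1 / 2" using p1 by linarith
    have "norm \<Delta> * (1 / 2) \<le> (1 - p) * norm \<Delta>"
      using p2 by (subst mult.commute) (intro mult_right_mono, auto)
    also have "\<dots> \<le> 2 * p * Re (W v - W (v + h))"
      using Harnack_norm[OF F_holomorphic[of h] Re_F_nonneg[of h] d] h nn
      unfolding p_def \<Delta>_def by (simp add: F_orbit)
    also have "\<dots> \<le> 2 * p * (2 / \<delta>\<^sup>2 * (L * h))"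
    proof (intro mult_left_mono)
      show "Re (W v - W (v + h)) \<le> 2 / \<delta>\<^sup>2 * (L * h)"
        using order_trans[OF complex_Re_le_cmod W_lip[of v "v + h"]] nn h by simp
    qed (simp add: p_def)
    also have "\<dots> \<le> 2 * (L / m * \<bar>u - v\<bar>) * (2 / \<delta>\<^sup>2 * (L * h))"
      using p1 L h by (intro mult_right_mono) auto
    finally have "norm \<Delta> \<le> 2 * (2 * (L / m * \<bar>u - v\<bar>) * (2 / \<delta>\<^sup>2 * (L * h)))" by simp
    also have "\<dots> = K * h * \<bar>u - v\<bar>" by (simp add: K_def)
    finally show "norm (W u - W (u + h) - (W v - W (v + h))) \<le> K * h * \<bar>u - v\<bar>" by (simp add: \<Delta>_def)
  qed (use r in auto)
qed

text \<open>Chain rule with the inverse Cayley transform.\<close>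

lemma orbit_has_vector_derivative:
  assumes t: "t > 0" shows "\<exists>D. (\<gamma> has_vector_derivative D) (at t)"
proof -
  obtain D where D: "(W has_vector_derivative D) (at t)" using W_has_vector_derivative[OF t] by blast
  have W: "W s + 1 \<noteq> 0 \<and> \<gamma> s = \<tau> * (W s - 1) / (W s + 1)" if s: "s \<ge> 0" for s
  proof -
    have ne: "\<tau> - \<gamma> s \<noteq> 0" "\<tau> \<noteq> 0" using norm_\<tau>_diff_pos[OF s] norm_\<tau> by auto
    have "W s + 1 = 2 * \<tau> / (\<tau> - \<gamma> s)" "W s - 1 = 2 * \<gamma> s / (\<tau> - \<gamma> s)"
      using ne by (simp_all add: W_def cayley_def field_simps)
    then show ?thesis using ne by simp
  qed
  define g where "g = (\<lambda>w. \<tau> * (w - 1) / (w + 1))"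
  have "g field_differentiable at (W t)"
    unfolding g_def using W[of t] t by (intro derivative_intros) auto
  then obtain g' where "(g has_field_derivative g') (at (W t))"
    by (auto simp: field_differentiable_def)
  from field_vector_diff_chain_at[OF D this]
  have "((g \<circ> W) has_vector_derivative D * g') (at t)" .
  then have "(\<gamma> has_vector_derivative D * g') (at t)"
    by (rule has_vector_derivative_transform_within_open[of _ _ _ "{0<..}"]) (use t W in \<open>auto simp: g_def\<close>)
  then show ?thesis by blast
qed

text \<open>Limit of the bound \<open>sp\<close> multiplied by \<open>n\<close>: the denominator of
  \<open>pdist\<close> tends to \<open>1 - (norm (\<gamma> t))\<^sup>2\<close>.\<close>

lemma orbit_hyp_speed_le:
  assumes sp: "\<And>t n. t \<ge> 0 \<Longrightarrow> n > 0 \<Longrightarrow> pdist (\<gamma> t) (\<gamma> (t + 1 / real n)) \<le> K / real n"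
    and t: "t \<ge> 0" and D: "(\<gamma> has_vector_derivative D) (at t)"
  shows "hyp_density (\<gamma> t) * norm D \<le> K"
proof -
  define s where "s = (\<lambda>k. inverse (real (Suc k)))"
  have s0: "s \<longlonglongrightarrow> 0" unfolding s_def by (rule LIMSEQ_inverse_real_of_nat)
  have sat: "filterlim s (at 0) sequentially"
    using s0 by (auto simp: filterlim_at s_def)
  have "((\<lambda>h. norm (\<gamma> (t + h) - \<gamma> t - h *\<^sub>R D) / norm h) \<longlongrightarrow> 0) (at 0)"
    using D unfolding has_vector_derivative_def has_derivative_at by simp
  from filterlim_compose[OF this sat]
  have "(\<lambda>k. norm (\<gamma> (t + s k) - \<gamma> t - s k *\<^sub>R D) / norm (s k)) \<longlonglongrightarrow> 0" .
  moreover have "norm (\<gamma> (t + s k) - \<gamma> t - s k *\<^sub>R D) / norm (s k) = norm (real (Suc k) *\<^sub>R (\<gamma> (t + s k) - \<gamma> t) - D)" for k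
  proof -
    have "\<gamma> (t + s k) - \<gamma> t - s k *\<^sub>R D = s k *\<^sub>R (real (Suc k) *\<^sub>R (\<gamma> (t + s k) - \<gamma> t) - D)"
      by (simp add: s_def scaleR_diff_right del: of_nat_Suc)
    then show ?thesis by (simp add: s_def del: of_nat_Suc)
  qed
  ultimately have "(\<lambda>k. real (Suc k) *\<^sub>R (\<gamma> (t + s k) - \<gamma> t)) \<longlonglongrightarrow> D"
    using LIM_zero_cancel tendsto_norm_zero_cancel by fastforce
  then have lim1: "(\<lambda>k. norm (real (Suc k) *\<^sub>R (\<gamma> (t + s k) - \<gamma> t))) \<longlonglongrightarrow> norm D" by (rule tendsto_norm)
  have "(\<lambda>k. \<gamma> (t + s k)) \<longlonglongrightarrow> \<gamma> t"
    by (rule continuous_on_tendsto_compose[OF continuous_orbit])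
       (use t tendsto_add[OF tendsto_const s0, of t] in \<open>auto simp: s_def\<close>)
  then have lim2: "(\<lambda>k. K * norm (1 - cnj (\<gamma> (t + s k)) * \<gamma> t)) \<longlonglongrightarrow> K * norm (1 - cnj (\<gamma> t) * \<gamma> t)"
    by (intro tendsto_mult tendsto_norm tendsto_diff tendsto_cnj tendsto_const)
  have "norm (real (Suc k) *\<^sub>R (\<gamma> (t + s k) - \<gamma> t)) \<le> K * norm (1 - cnj (\<gamma> (t + s k)) * \<gamma> t)" for k
  proof -
    have d: "norm (\<gamma> t) < 1" "norm (\<gamma> (t + s k)) < 1" using t by (auto intro: orbit_in_disk simp: s_def)
    define N where "N = norm (1 - cnj (\<gamma> (t + s k)) * \<gamma> t)"
    have N: "N > 0" unfolding N_def by (rule one_minus_cnj_pos[OF d(2,1)])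
    have "pdist (\<gamma> t) (\<gamma> (t + s k)) \<le> K / real (Suc k)"
      using sp[OF t, of "Suc k"] by (simp add: s_def inverse_eq_divide del: of_nat_Suc)
    then have "norm (\<gamma> t - \<gamma> (t + s k)) \<le> K / real (Suc k) * N"
      using N by (simp add: pdist_def N_def[symmetric] pos_divide_le_eq del: of_nat_Suc)
    then have "norm (\<gamma> (t + s k) - \<gamma> t) * real (Suc k) \<le> K * N"
      by (simp add: norm_minus_commute field_simps del: of_nat_Suc)
    then show ?thesis by (simp add: N_def mult.commute del: of_nat_Suc)
  qed
  then have "norm D \<le> K * norm (1 - cnj (\<gamma> t) * \<gamma> t)"
    using LIMSEQ_le[OF lim1 lim2] by blast
  also have "1 - cnj (\<gamma> t) * \<gamma> t = of_real (1 - (norm (\<gamma> t))\<^sup>2)"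
    using complex_norm_square[of "\<gamma> t"] by (simp add: mult.commute)
  also have "norm \<dots> = 1 - (norm (\<gamma> t))\<^sup>2"
    using orbit_in_disk[OF t] by (simp add: abs_square_le_1 del: of_real_diff)
  finally show ?thesis
    using orbit_in_disk[OF t] by (simp add: hyp_density_def abs_square_less_1 pos_divide_le_eq)
qed

lemma hyp_length_orbit_le: "\<exists>K>0. \<forall>t1 t2. 0 \<le> t1 \<longrightarrow> t1 \<le> t2 \<longrightarrow> hyp_length \<gamma> t1 t2 \<le> K * (t2 - t1)"
proof -
  obtain K where K: "K > 0"
    and sp: "\<And>t n. t \<ge> 0 \<Longrightarrow> n > 0 \<Longrightarrow> pdist (\<gamma> t) (\<gamma> (t + 1 / real n)) \<le> K / real n"
    using orbit_speed by metis
  have "hyp_length \<gamma> t1 t2 \<le> K * (t2 - t1)" if t: "0 \<le> t1" "t1 \<le> t2" for t1 t2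
  proof -
    define g where "g = (\<lambda>t. hyp_density (\<gamma> t) * norm (vector_derivative \<gamma> (at t within {t1..t2})))"
    \<comment> \<open>Interior points suffice, as the endpoints form a null set; differentiability
      is only known for positive times.\<close>
    have g: "g t \<le> K" if s: "t \<in> {t1<..<t2}" for t
    proof -
      obtain D where D: "(\<gamma> has_vector_derivative D) (at t)"
        using orbit_has_vector_derivative[of t] s t by auto
      have "vector_derivative \<gamma> (at t within {t1..t2}) = D"
        using s by (intro vector_derivative_at_within_ivl[OF D]) auto
      then show ?thesis using orbit_hyp_speed_le[OF sp _ D] s t by (simp add: g_def)
    qed
    have "integral {t1..t2} g \<le> K * (t2 - t1)"
    proof (cases "g integrable_on {t1..t2}")
      case True
      have "integral (box t1 t2) g \<le> integral (box t1 t2) (\<lambda>_. K)"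
      proof (rule integral_le)
        show "g integrable_on box t1 t2" "(\<lambda>_. K) integrable_on box t1 t2"
          unfolding integrable_on_open_interval using True by auto
      qed (use g in auto)
      then have "integral (cbox t1 t2) g \<le> integral (cbox t1 t2) (\<lambda>_. K)"
        unfolding integral_open_interval .
      then show ?thesis using t by (simp add: mult.commute)
    next
      \<comment> \<open>The integral then has the default value \<open>0\<close>, so integrability
        need not be established.\<close>
      case False
      then show ?thesis using K t by (simp add: not_integrable_integral)
    qed
    then show ?thesis by (simp add: hyp_length_def g_def)
  qed
  with K show ?thesis by blast
qed

section \<open>Linear growth of the distance and conclusion\<close>

text \<open>By the Schwarz-Pick lemma the pseudo-hyperbolic distance of \<open>\<gamma> t1\<close> and \<open>\<gamma> t2\<close> is at least that
  of \<open>\<gamma> 0\<close> and \<open>\<gamma> (t2 - t1)\<close>, so that exponential decay of \<open>1 - \<bar>\<gamma>\<bar>\<close> suffices.\<close>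
lemma hyp_dist_orbit_ge:
  "\<exists>c C. c > 0 \<and> (\<forall>t1 t2. 0 \<le> t1 \<longrightarrow> t1 \<le> t2 \<longrightarrow> c * (t2 - t1) - C \<le> hyp_dist (\<gamma> t1) (\<gamma> t2))"
proof -
  obtain K c where K: "K > 0" and c: "c > 0"
    and decay: "\<And>t. t \<ge> 0 \<Longrightarrow> 1 - norm (\<gamma> t) \<le> K * exp (- c * t)"
    using orbit_decay by metis
  define E where "E = 4 * K / (1 - norm (\<gamma> 0))"
  have E: "E > 0" using K orbit_in_disk[of 0] by (simp add: E_def)
  have "c / 2 * (t2 - t1) - ln E / 2 \<le> hyp_dist (\<gamma> t1) (\<gamma> t2)" if t: "0 \<le> t1" "t1 \<le> t2" for t1 t2
  proof -
    define d where "d = t2 - t1"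
    have d: "d \<ge> 0" using t by (simp add: d_def)
    have dsk: "norm (\<gamma> 0) < 1" "norm (\<gamma> d) < 1" "norm (\<gamma> t1) < 1" "norm (\<gamma> t2) < 1"
      using t d by (auto intro: orbit_in_disk)
    have "pdist (\<gamma> 0) (\<gamma> d) \<le> pdist (\<gamma> t1) (\<gamma> t2)"
      using pdist_orbit_increasing[of 0 d t1] t d by (simp add: d_def)
    then have "(1 - pdist (\<gamma> t1) (\<gamma> t2)) * (1 - norm (\<gamma> 0)) \<le> (1 - pdist (\<gamma> 0) (\<gamma> d)) * (1 - norm (\<gamma> 0))"
      using dsk by (intro mult_right_mono) auto
    also have "\<dots> \<le> 4 * (1 - norm (\<gamma> d))" by (rule pdist_le_imp_comparable[OF dsk(1,2)])
    also have "\<dots> \<le> 4 * (K * exp (- c * d))" using decay[OF d] by simp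
    finally have "1 - pdist (\<gamma> t1) (\<gamma> t2) \<le> E * exp (- c * d)"
      using dsk by (simp add: E_def field_simps)
    then have "ln (1 - pdist (\<gamma> t1) (\<gamma> t2)) \<le> ln (E * exp (- c * d))"
      using pdist_lt_1[OF dsk(3,4)] by (intro ln_mono) auto
    also have "\<dots> = ln E - c * d" using E by (simp add: ln_mult)
    finally show ?thesis using hyp_dist_ge[OF dsk(3,4)] by (simp add: d_def)
  qed
  moreover have "c / 2 > 0" using c by simp
  ultimately show ?thesis by blast
qed

text \<open>Length grows at most, and distance at least, linearly in \<open>t2 - t1\<close>;
  eliminating \<open>t2 - t1\<close> gives the ratio \<open>K / c\<close>.\<close>

lemma orbit_quasi_geodesic: "quasi_geodesic \<gamma>"
proof -
  obtain K where K: "K > 0" and len: "\<And>t1 t2. 0 \<le> t1 \<Longrightarrow> t1 \<le> t2 \<Longrightarrow> hyp_length \<gamma> t1 t2 \<le> K * (t2 - t1)"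
    using hyp_length_orbit_le by metis
  obtain c C where c: "c > 0"
    and dist: "\<And>t1 t2. 0 \<le> t1 \<Longrightarrow> t1 \<le> t2 \<Longrightarrow> c * (t2 - t1) - C \<le> hyp_dist (\<gamma> t1) (\<gamma> t2)"
    using hyp_dist_orbit_ge by metis
  have nonneg: "hyp_dist (\<gamma> t1) (\<gamma> t2) \<ge> 0" if "0 \<le> t1" "t1 \<le> t2" for t1 t2
  proof -
    have dsk: "norm (\<gamma> t1) < 1" "norm (\<gamma> t2) < 1" using that by (auto intro: orbit_in_disk)
    have "ln (1 - pdist (\<gamma> t1) (\<gamma> t2)) \<le> 0" using pdist_lt_1[OF dsk] by simp
    then show ?thesis using hyp_dist_ge[OF dsk] by simp
  qed
  \<comment> \<open>Enlarging \<open>K / c\<close> to \<open>A\<close> is harmless because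
    \<open>hyp_dist\<close> is nonnegative on the orbit.\<close>
  define A where "A = max 1 (K / c)"
  define B where "B = K / c * \<bar>C\<bar>"
  have len2: "hyp_length \<gamma> t1 t2 \<le> A * hyp_dist (\<gamma> t1) (\<gamma> t2) + B" if t: "0 \<le> t1" "t1 \<le> t2" for t1 t2
  proof -
    have "hyp_length \<gamma> t1 t2 \<le> K * (t2 - t1)" by (rule len[OF t])
    also have "\<dots> = K / c * (c * (t2 - t1))" using c by simp
    also have "\<dots> \<le> K / c * (hyp_dist (\<gamma> t1) (\<gamma> t2) + \<bar>C\<bar>)"
      using dist[OF t] K c by (intro mult_left_mono) auto
    also have "\<dots> = K / c * hyp_dist (\<gamma> t1) (\<gamma> t2) + B" by (simp only: B_def distrib_left)
    also have "\<dots> \<le> A * hyp_dist (\<gamma> t1) (\<gamma> t2) + B"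
      using nonneg[OF t] by (intro add_right_mono mult_right_mono) (auto simp: A_def)
    finally show ?thesis .
  qed
  have AB: "A \<ge> 1" "B \<ge> 0" using K c by (auto simp: A_def B_def)
  have lim: "filterlim (\<lambda>t. hyp_dist (\<gamma> 0) (\<gamma> t)) at_top at_top"
  proof (rule filterlim_at_top_mono)
    show "filterlim (\<lambda>t. - C + c * t) at_top at_top"
      by (intro filterlim_tendsto_add_at_top[OF tendsto_const]
           filterlim_tendsto_pos_mult_at_top[OF tendsto_const c] filterlim_ident)
    show "\<forall>\<^sub>F t in at_top. - C + c * t \<le> hyp_dist (\<gamma> 0) (\<gamma> t)"
      using eventually_ge_at_top[of "0::real"]
      by eventually_elim (use dist[of 0] in \<open>auto simp: algebra_simps\<close>)
  qed
  have "\<gamma> \<in> {0..} \<rightarrow> unit_disk" by (auto intro: orbit_in_disk)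
  moreover have "\<exists>L. L-lipschitz_on {0..} \<gamma>" using orbit_lipschitz by blast
  ultimately show ?thesis
    unfolding quasi_geodesic_def using lim AB len2 by blast
qed

end

theorem theorem1p1:
  fixes \<phi> :: "real \<Rightarrow> complex \<Rightarrow> complex" and \<gamma> :: "real \<Rightarrow> complex" and \<sigma> :: complex
  assumes "disk_semigroup \<phi>"
    and "non_elliptic \<phi>"
    and "regular_backward_orbit \<phi> \<gamma>"
    and "\<sigma> \<in> sphere 0 1"
    and "converges_non_tangentially \<gamma> \<sigma>"
  shows "quasi_geodesic \<gamma>"
proof -
  obtain \<tau> where "norm \<tau> = 1" "\<And>t z. t \<ge> 0 \<Longrightarrow> norm z < 1 \<Longrightarrow> horo \<tau> z \<le> horo \<tau> (\<phi> t z)"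
    using Denjoy_Wolff_point[OF assms(1,2)] by metis
  with assms interpret nontangential_orbit \<phi> \<gamma> \<sigma> \<tau>
    by unfold_locales auto
  show ?thesis by (rule orbit_quasi_geodesic)
qed

end
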